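(* Let $\theta\in(0,1)\setminus\mathbb{Q}$ and $N\in\mathbb{N}=\{1,2,\ldots\}$. Then \[ \sqrt{\frac{\theta q^\theta_N-p^\theta_N}{\left(\theta q^\theta_{N-2}-p^\theta_{N-2}\right)r^\theta_N(r^\theta_N+1)^2}}\cdot\|a\|_{\mathrm{op}}\le\|a\|_{\mathbf{v}_{\theta,N},\mathcal{B}_{\theta,N}}\le\|a\|_{\mathrm{op}} \] for all $a\in\mathcal{A}_{\theta,N}$. If $(\theta_n)_{n\in\mathbb{N}}$ is a sequence in $(0,1)\setminus\mathbb{Q}$ converging to some $\theta\in(0,1)\setminus\mathbb{Q}$, then \[ \lim_{n\to\infty}\frac{\theta_nq^{\theta_n}_N-p^{\theta_n}_N}{\left(\theta_nq^{\theta_n}_{N-2}-p^{\theta_n}_{N-2}\right)r^{\theta_n}_N(r^{\theta_n}_N+1)^2}=\frac{\theta q^\theta_N-p^\theta_N}{\left(\theta q^\theta_{N-2}-p^\theta_{N-2}\right)r^\theta_N(r^\theta_N+1)^2}. \]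
   Context: Continued fractions: for irrational $\theta\in(0,1)$, $(r^\theta_n)_{n\ge0}$ is its continued fraction expansion, i.e. $r^\theta_0=0$, $r^\theta_n$ is a positive integer for $n\ge1$, and $\theta=\lim_{n\to\infty}[r^\theta_0;r^\theta_1,\ldots,r^\theta_n]$. Define $p^\theta_0=r^\theta_0=0$, $p^\theta_1=1$, $q^\theta_0=1$, $q^\theta_1=r^\theta_1$, and for $n\ge1$: $p^\theta_{n+1}=r^\theta_{n+1}p^\theta_n+p^\theta_{n-1}$, $q^\theta_{n+1}=r^\theta_{n+1}q^\theta_n+q^\theta_{n-1}$. By convention $p^\theta_{-1}=1$, $q^\theta_{-1}=0$ (used only when $N=1$). Algebras: $\mathcal{M}_n$ is the C*-algebra of complex $n\times n$ matrices with the operator norm; on a direct sum, $\|\cdot\|_{\mathrm{op}}$ is the maximum of the operator norms of the coordinates. Set $\mathcal{A}_{\theta,0}=\mathbb{C}$ and $\mathcal{A}_{\theta,n}=\mathcal{M}_{q^\theta_n}\oplus\mathcal{M}_{q^\theta_{n-1}}$ for $n\ge1$. For $n\ge1$ let $\alpha_{\theta,n}:\mathcal{A}_{\theta,n}\to\mathcal{A}_{\theta,n+1}$, $\alpha_{\theta,n}(A\oplus B)=\mathrm{diag}(A,\ldots,A,B)\oplus A$, with $r^\theta_{n+1}$ copies of $A$ in the first summand; and $\alpha_{\theta,0}:\mathbb{C}\to\mathcal{A}_{\theta,1}$, $\alpha_{\theta,0}(\lambda)=\mathrm{diag}(\lambda,\ldots,\lambda)\oplus\lambda$. These are unital *-monomorphisms.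 For $n\ge0$ put $\mathcal{B}_{\theta,n+1}=\alpha_{\theta,n}(\mathcal{A}_{\theta,n})$, a unital C*-subalgebra of $\mathcal{A}_{\theta,n+1}$. Norms: for $n\ge1$ let $t(\theta,n)=(-1)^{n-1}q^\theta_n(\theta q^\theta_{n-1}-p^\theta_{n-1})\in(0,1)$ and $\mathbf{v}_{\theta,n}=(t(\theta,n),1-t(\theta,n))$, with associated faithful tracial state on $\mathcal{A}_{\theta,n}$ \[ \tau_{\mathbf{v}_{\theta,n}}(A,B)=\frac{t(\theta,n)}{q^\theta_n}\mathrm{Tr}(A)+\frac{1-t(\theta,n)}{q^\theta_{n-1}}\mathrm{Tr}(B). \] Let $P:\mathcal{A}_{\theta,n}\to\mathcal{B}_{\theta,n}$ be the unique conditional expectation onto $\mathcal{B}_{\theta,n}$ (linear, $P(b)=b$ for $b\in\mathcal{B}_{\theta,n}$, $\|P(a)\|_{\mathrm{op}}\le\|a\|_{\mathrm{op}}$) with $\tau_{\mathbf{v}_{\theta,n}}\circ P=\tau_{\mathbf{v}_{\theta,n}}$; equivalently, the orthogonal projection onto $\mathcal{B}_{\theta,n}$ for the inner product $\langle a,b\rangle=\tau_{\mathbf{v}_{\theta,n}}(b^*a)$. The Frobenius--Rieffel norm is $\|a\|_{\mathbf{v}_{\theta,n},\mathcal{B}_{\theta,n}}=\sqrt{\|P(a^*a)\|_{\mathrm{op}}}$. *)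

theory Defs
  imports
    "HOL-Library.FuncSet"
    "HOL-Analysis.L2_Norm"
    "Jordan_Normal_Form.Schur_Decomposition"
begin

section \<open>Continued fractions\<close>

text \<open>
  \<open>fin_cf r n\<close> is the finite continued fraction $[r_0; r_1, \ldots, r_n]$.
\<close>

fun fin_cf :: "(nat \<Rightarrow> nat) \<Rightarrow> nat \<Rightarrow> real" where
  "fin_cf r 0 = real (r 0)"
| "fin_cf r (Suc n) = real (r 0) + 1 / fin_cf (\<lambda>k. r (Suc k)) n"

text \<open>
  The expansion is determined only for irrational \<open>\<theta> \<in> (0, 1)\<close>; for other arguments
  \<open>cf_term\<close>, and everything built on it, is unspecified.
\<close>

definition cf_term :: "real \<Rightarrow> nat \<Rightarrow> nat" where
  "cf_term \<theta> = (THE r. r 0 = 0 \<and> (\<forall>n\<ge>1. r n > 0) \<and> fin_cf r \<longlonglongrightarrow> \<theta>)"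

fun cf_num :: "real \<Rightarrow> nat \<Rightarrow> nat" where
  "cf_num \<theta> 0 = 0"
| "cf_num \<theta> (Suc 0) = 1"
| "cf_num \<theta> (Suc (Suc n)) = cf_term \<theta> (Suc (Suc n)) * cf_num \<theta> (Suc n) + cf_num \<theta> n"

fun cf_den :: "real \<Rightarrow> nat \<Rightarrow> nat" where
  "cf_den \<theta> 0 = 1"
| "cf_den \<theta> (Suc 0) = cf_term \<theta> 1"
| "cf_den \<theta> (Suc (Suc n)) = cf_term \<theta> (Suc (Suc n)) * cf_den \<theta> (Suc n) + cf_den \<theta> n"

text \<open>
  The same sequences with integer indices \<open>k \<ge> -1\<close>, where by convention $p_{-1} = 1$ and
  $q_{-1} = 0$.
\<close>

definition cf_p :: "real \<Rightarrow> int \<Rightarrow> real" where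
  "cf_p \<theta> k = (if k = -1 then 1 else real (cf_num \<theta> (nat k)))"

definition cf_q :: "real \<Rightarrow> int \<Rightarrow> real" where
  "cf_q \<theta> k = (if k = -1 then 0 else real (cf_den \<theta> (nat k)))"


section \<open>Direct sums of two matrix algebras\<close>

definition vec_l2norm :: "complex vec \<Rightarrow> real" where
  "vec_l2norm v = L2_set (\<lambda>i. cmod (v $ i)) {..<dim_vec v}"

definition mat_opnorm :: "complex mat \<Rightarrow> real" where
  "mat_opnorm A =
     (SUP v\<in>{v \<in> carrier_vec (dim_col A). vec_l2norm v \<le> 1}. vec_l2norm (A *\<^sub>v v))"

definition mat_tr :: "complex mat \<Rightarrow> complex" where
  "mat_tr A = (\<Sum>i<dim_row A. A $$ (i, i))"

type_synonym dsum = "complex mat \<times> complex mat"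

definition ds_add :: "dsum \<Rightarrow> dsum \<Rightarrow> dsum" where
  "ds_add a b = (fst a + fst b, snd a + snd b)"

definition ds_scale :: "complex \<Rightarrow> dsum \<Rightarrow> dsum" where
  "ds_scale c a = (c \<cdot>\<^sub>m fst a, c \<cdot>\<^sub>m snd a)"

definition ds_mult :: "dsum \<Rightarrow> dsum \<Rightarrow> dsum" where
  "ds_mult a b = (fst a * fst b, snd a * snd b)"

definition ds_star :: "dsum \<Rightarrow> dsum" where
  "ds_star a = (mat_adjoint (fst a), mat_adjoint (snd a))"

definition opnorm :: "dsum \<Rightarrow> real" where
  "opnorm a = max (mat_opnorm (fst a)) (mat_opnorm (snd a))"


section \<open>The algebras\<close>

text \<open>
  \<open>AF \<theta> n\<close> is $\mathcal{A}_{\theta,n}$ for \<open>n \<ge> 1\<close>. The algebra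
  $\mathcal{A}_{\theta,0} = \mathbb{C}$ is represented by the type \<^typ>\<open>complex\<close>, and
  \<open>AF \<theta> 0\<close> is not meaningful; hence the separate embedding \<open>AF_emb0\<close>.
\<close>

definition AF :: "real \<Rightarrow> nat \<Rightarrow> dsum set" where
  "AF \<theta> n = carrier_mat (cf_den \<theta> n) (cf_den \<theta> n)
           \<times> carrier_mat (cf_den \<theta> (n - 1)) (cf_den \<theta> (n - 1))"

definition AF_emb0 :: "real \<Rightarrow> complex \<Rightarrow> dsum" where
  "AF_emb0 \<theta> c = (c \<cdot>\<^sub>m 1\<^sub>m (cf_den \<theta> 1), c \<cdot>\<^sub>m 1\<^sub>m (cf_den \<theta> 0))"

definition AF_emb :: "real \<Rightarrow> nat \<Rightarrow> dsum \<Rightarrow> dsum" where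
  "AF_emb \<theta> n a =
     (diag_block_mat (replicate (cf_term \<theta> (n + 1)) (fst a) @ [snd a]), fst a)"

definition AF_sub :: "real \<Rightarrow> nat \<Rightarrow> dsum set" where
  "AF_sub \<theta> n = (if n = 1 then range (AF_emb0 \<theta>) else AF_emb \<theta> (n - 1) ` AF \<theta> (n - 1))"


section \<open>Traces, conditional expectations and Frobenius--Rieffel norms\<close>

definition AF_t :: "real \<Rightarrow> nat \<Rightarrow> real" where
  "AF_t \<theta> n =
     (-1) ^ (n - 1) * real (cf_den \<theta> n)
       * (\<theta> * real (cf_den \<theta> (n - 1)) - real (cf_num \<theta> (n - 1)))"

definition AF_tau :: "real \<Rightarrow> nat \<Rightarrow> dsum \<Rightarrow> complex" where
  "AF_tau \<theta> n a =
     of_real (AF_t \<theta> n / real (cf_den \<theta> n)) * mat_tr (fst a)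
     + of_real ((1 - AF_t \<theta> n) / real (cf_den \<theta> (n - 1))) * mat_tr (snd a)"

definition is_cond_exp :: "dsum set \<Rightarrow> dsum set \<Rightarrow> (dsum \<Rightarrow> dsum) \<Rightarrow> bool" where
  "is_cond_exp A B P \<longleftrightarrow>
     P \<in> A \<rightarrow> B \<and>
     (\<forall>a\<in>A. \<forall>b\<in>A. P (ds_add a b) = ds_add (P a) (P b)) \<and>
     (\<forall>c. \<forall>a\<in>A. P (ds_scale c a) = ds_scale c (P a)) \<and>
     (\<forall>b\<in>B. P b = b) \<and>
     (\<forall>a\<in>A. opnorm (P a) \<le> opnorm a)"

text \<open>
  Membership in \<^term>\<open>extensional A\<close> fixes the values off \<open>A\<close>, so that uniqueness of the
  trace-preserving conditional expectation on \<open>A\<close> becomes uniqueness as a HOL function.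
\<close>

definition cond_exp :: "dsum set \<Rightarrow> dsum set \<Rightarrow> (dsum \<Rightarrow> complex) \<Rightarrow> dsum \<Rightarrow> dsum" where
  "cond_exp A B \<tau> =
     (THE P. P \<in> extensional A \<and> is_cond_exp A B P \<and> (\<forall>a\<in>A. \<tau> (P a) = \<tau> a))"

definition FR_norm :: "real \<Rightarrow> nat \<Rightarrow> dsum \<Rightarrow> real" where
  "FR_norm \<theta> n a =
     sqrt (opnorm (cond_exp (AF \<theta> n) (AF_sub \<theta> n) (AF_tau \<theta> n) (ds_mult (ds_star a) a)))"

end

theory Submission
  imports Defs
begin

text \<open>
  Let \<open>\<delta>\<^sub>k = \<bar>\<theta> q\<^sub>k - p\<^sub>k\<bar>\<close>. The conditional expectation replaces the \<open>r = r\<^sub>N\<close> large diagonal blocks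
  of the first summand, with weight \<open>\<delta>\<close> at \<open>N - 1\<close> each, and the second summand, with weight
  \<open>\<delta>\<close> at \<open>N\<close>, by their weighted mean; the total weight is \<open>\<delta>\<close> at \<open>N - 2\<close>. Hence the norm of each
  diagonal block of \<open>a\<^sup>* a\<close> is controlled by the norm of \<open>P(a\<^sup>* a)\<close>, and cutting a vector into \<open>r + 1\<close>
  blocks costs a factor of at most \<open>r + 1\<close> in the norm of \<open>a\<close>. Continuity holds since the
  \<open>\<delta>\<^sub>k\<close> are products of inverse complete quotients, which are continuous at irrational points.

  The conditional expectation \<open>P\<close> is unique because, for a projection \<open>e\<close> of the subalgebra, the
  functional \<open>a \<mapsto> \<tau>(e P(a))\<close> attains its norm at \<open>e\<close>, which forces \<open>\<tau>(e P(a)) = \<tau>(a e)\<close>.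
\<close>

section \<open>Complete quotients of continued fractions\<close>

text \<open>\<open>cond_exp\<close> is a definite description, and \<open>is_cond_exp\<close> asks
  for linearity and contractivity but not for the bimodule property. Identifying it with block
  averaging therefore needs a uniqueness proof from contractivity and trace invariance, in the
  spirit of Tomiyama's theorem but with traces. Averaging forgets the off-diagonal blocks of
  \<open>a^* a\<close>; this does no harm, because the quadratic form of a diagonal block of
  \<open>a^* a\<close> is the squared norm of a on vectors supported in that block. The \<delta>_k
  decrease, so each averaged block has weight at least \<delta>_N. The ratio of \<delta>_N to the
  total weight and the squared block count (r + 1)^2 make up the constant; its further factor r is
  slack, since r is at least 1. The trace is brought to these weights by q_N \<delta>_{N-1} +
  q_{N-1} \<delta>_N = 1.\<close>

definition cf_step :: "real \<Rightarrow> real" where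
  "cf_step x = 1 / frac x"

lemma frac_irrational:
  fixes x :: real
  assumes "x \<notin> \<rat>"
  shows "frac x \<notin> \<rat>" "0 < frac x" "frac x < 1"
proof -
  show *: "frac x \<notin> \<rat>"
    using assms Rats_add[OF _ Rats_of_int[of "\<lfloor>x\<rfloor>"], of "frac x"] by (auto simp: frac_def)
  then have "frac x \<noteq> 0" using Rats_0 by metis
  then show "0 < frac x" "frac x < 1"
    using frac_ge_0[of x] frac_lt_1[of x] by linarith+
qed

lemma cf_step_irrational:
  assumes "x \<notin> \<rat>"
  shows "cf_step x \<notin> \<rat>" "cf_step x > 1"
proof -
  show "cf_step x \<notin> \<rat>"
    using frac_irrational(1)[OF assms] Rats_inverse[of "cf_step x"] 
    by (auto simp: cf_step_def inverse_eq_divide)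
  show "cf_step x > 1"
    using frac_irrational[OF assms] by (simp add: cf_step_def)
qed

text \<open>The complete quotients. Index 0 is x itself, so for irrational x in (0, 1) they exceed 1
  only from index 1 on.\<close>

definition cf_quot :: "real \<Rightarrow> nat \<Rightarrow> real" where
  "cf_quot x n = (cf_step ^^ n) x"

lemma cf_quot_0 [simp]: "cf_quot x 0 = x"
  by (simp add: cf_quot_def)

lemma cf_quot_Suc: "cf_quot x (Suc n) = cf_step (cf_quot x n)"
  by (simp add: cf_quot_def)

lemma cf_quot_Suc': "cf_quot x (Suc n) = cf_quot (cf_step x) n"
  by (simp add: cf_quot_def funpow_swap1)

lemma cf_quot_irrational:
  assumes "x \<notin> \<rat>"
  shows "cf_quot x n \<notin> \<rat>"
  by (induction n) (use assms cf_step_irrational in \<open>auto simp: cf_quot_Suc\<close>)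

lemma cf_quot_Suc_gt_1:
  assumes "x \<notin> \<rat>"
  shows "cf_quot x (Suc n) > 1"
  using cf_step_irrational(2) cf_quot_irrational assms by (simp add: cf_quot_Suc)

definition cf_digit :: "real \<Rightarrow> nat \<Rightarrow> nat" where
  "cf_digit x n = nat \<lfloor>cf_quot x n\<rfloor>"

lemma cf_digit_Suc': "cf_digit x (Suc n) = cf_digit (cf_step x) n"
  by (simp add: cf_digit_def cf_quot_Suc')

lemma cf_digit_Suc_pos:
  assumes "x \<notin> \<rat>"
  shows "cf_digit x (Suc n) > 0"
  using cf_quot_Suc_gt_1[OF assms, of n] by (simp add: cf_digit_def)

lemma cf_digit_Suc_eq:
  assumes "x \<notin> \<rat>"
  shows "real (cf_digit x (Suc n)) = cf_quot x (Suc n) - 1 / cf_quot x (Suc (Suc n))"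
proof -
  have "1 < cf_quot x (Suc n)" by (rule cf_quot_Suc_gt_1[OF assms])
  then show ?thesis
    by (simp add: cf_digit_def cf_quot_Suc[of x "Suc n"] cf_step_def frac_def)
qed

section \<open>Uniqueness and convergence of the infinite expansion\<close>

lemma fin_cf_ge_1:
  assumes "\<And>n. r n > 0"
  shows "fin_cf r n \<ge> 1"
  using assms
proof (induction n arbitrary: r)
  case 0
  then show ?case by (simp add: Suc_le_eq)
next
  case (Suc n)
  have "1 \<le> fin_cf (\<lambda>k. r (Suc k)) n" by (intro Suc)
  then have "0 \<le> 1 / fin_cf (\<lambda>k. r (Suc k)) n" by simp
  moreover have "1 \<le> real (r 0)" using Suc.prems[of 0] by (simp del: of_nat_le_iff add: Suc_le_eq)
  ultimately show ?case unfolding fin_cf.simps by linarith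
qed

text \<open>The tails are at least 1, so their reciprocals lie in [0, 1] and converge to
  \<open>x - r 0\<close>. Irrationality excludes both endpoints, which makes \<open>r 0\<close> the
  floor and allows the limit to be inverted.\<close>

lemma fin_cf_limit_tail:
  assumes lim: "fin_cf r \<longlonglongrightarrow> x" and x: "x \<notin> \<rat>" and pos: "\<And>n. n \<ge> 1 \<Longrightarrow> r n > 0"
  shows "r 0 = nat \<lfloor>x\<rfloor>" "fin_cf (\<lambda>k. r (Suc k)) \<longlonglongrightarrow> cf_step x"
proof -
  let ?t = "fin_cf (\<lambda>k. r (Suc k))"
  have ge: "?t n \<ge> 1" for n by (rule fin_cf_ge_1) (auto intro: pos)
  have lim': "(\<lambda>n. 1 / ?t n) \<longlonglongrightarrow> x - real (r 0)"
  proof -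
    have "(\<lambda>n. fin_cf r (Suc n) - real (r 0)) \<longlonglongrightarrow> x - real (r 0)"
      by (rule tendsto_diff[OF LIMSEQ_Suc[OF lim] tendsto_const])
    then show ?thesis by simp
  qed
  have b: "0 \<le> 1 / ?t n" "1 / ?t n \<le> 1" for n
    using ge[of n] by (simp_all del: fin_cf.simps add: divide_le_eq_1)
  have ge0: "0 \<le> x - real (r 0)" and le1: "x - real (r 0) \<le> 1"
    using LIMSEQ_le_const[OF lim'] LIMSEQ_le_const2[OF lim'] b by blast+
  have ne: "x - real (r 0) \<noteq> 0" "x - real (r 0) \<noteq> 1"
    using x by (auto simp: diff_eq_eq)
  have fl: "\<lfloor>x\<rfloor> = int (r 0)"
    using ge0 le1 ne by (simp add: floor_eq_iff)
  then have fr: "x - real (r 0) = frac x" by (simp add: frac_def)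
  have "(\<lambda>n. 1 / (1 / ?t n)) \<longlonglongrightarrow> 1 / frac x"
    by (intro tendsto_divide tendsto_const) (use lim' fr ne in auto)
  then show "?t \<longlonglongrightarrow> cf_step x" by (simp add: cf_step_def)
  show "r 0 = nat \<lfloor>x\<rfloor>" by (simp add: fl)
qed

lemma fin_cf_limit_digit:
  assumes "fin_cf r \<longlonglongrightarrow> x" "x \<notin> \<rat>" "\<And>n. n \<ge> 1 \<Longrightarrow> r n > 0"
  shows "r n = cf_digit x n"
  using assms
proof (induction n arbitrary: r x)
  case 0
  then show ?case using fin_cf_limit_tail(1)[of r x] by (simp add: cf_digit_def)
next
  case (Suc n)
  have "r (Suc n) = cf_digit (cf_step x) n"
    by (rule Suc.IH[of "\<lambda>k. r (Suc k)"])
      (use fin_cf_limit_tail(2)[of r x] Suc.prems cf_step_irrational in auto)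
  then show ?case by (simp add: cf_digit_Suc')
qed

lemma fin_cf_digit_Suc:
  "fin_cf (cf_digit x) (Suc n) = real (cf_digit x 0) + 1 / fin_cf (cf_digit (cf_step x)) n"
  by (simp add: cf_digit_Suc')

lemma fin_cf_digit_ge_1:
  assumes "x \<notin> \<rat>" "x > 1"
  shows "fin_cf (cf_digit x) n \<ge> 1"
proof (rule fin_cf_ge_1)
  show "cf_digit x n > 0" for n
    using assms cf_digit_Suc_pos[of x "n - 1"] by (cases n) (simp_all add: cf_digit_def)
qed

lemma cf_digit_0_plus:
  assumes "x > 0"
  shows "x = real (cf_digit x 0) + 1 / cf_step x"
  using assms by (simp add: cf_digit_def cf_step_def frac_def)

text \<open>Since 1/y - 1/f = (f - y) / (y f) and f is at least 1, prepending a digit shrinks the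
  error by the complete quotient y.\<close>

lemma fin_cf_digit_error_Suc:
  assumes "x \<notin> \<rat>" "x > 0"
  shows "\<bar>x - fin_cf (cf_digit x) (Suc n)\<bar>
    \<le> \<bar>cf_step x - fin_cf (cf_digit (cf_step x)) n\<bar> / cf_step x"
proof -
  let ?y = "cf_step x"
  let ?f = "fin_cf (cf_digit ?y) n"
  note y = cf_step_irrational[OF assms(1)]
  have f: "1 \<le> ?f" by (intro fin_cf_digit_ge_1 y)
  have "x - fin_cf (cf_digit x) (Suc n) = 1 / ?y - 1 / ?f"
    using cf_digit_0_plus[OF assms(2)] unfolding fin_cf_digit_Suc by linarith
  also have "\<bar>\<dots>\<bar> = \<bar>?y - ?f\<bar> / ?y / ?f"
    using f y by (simp add: field_simps abs_divide abs_minus_commute)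
  also have "\<dots> \<le> \<bar>?y - ?f\<bar> / ?y / 1"
    using f y by (intro divide_left_mono) auto
  finally show ?thesis by simp
qed

text \<open>One complete quotient may be arbitrarily close to 1, so a single digit need not improve
  the error noticeably; two in a row do. The reason is x >= 1 + frac x > 2 frac x.\<close>

lemma cf_step_mult_ge_2:
  assumes "x \<notin> \<rat>" "x > 1"
  shows "x * cf_step x \<ge> 2"
proof -
  have "1 \<le> \<lfloor>x\<rfloor>" using assms by simp
  then have "1 \<le> real_of_int \<lfloor>x\<rfloor>" by simp
  moreover have "x = real_of_int \<lfloor>x\<rfloor> + frac x" by (simp add: frac_def)
  ultimately have "2 * frac x \<le> x" using frac_irrational(3)[OF assms(1)] by argo
  then show ?thesis using frac_irrational[OF assms(1)] by (simp add: cf_step_def field_simps)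
qed

text \<open>The induction drops two digits at once, because only the product of two consecutive
  quotients is bounded away from 1; hence the exponent \<open>n div 2\<close>.\<close>

lemma fin_cf_digit_error:
  assumes "x \<notin> \<rat>" "x > 0"
  shows "\<bar>x - fin_cf (cf_digit x) n\<bar> \<le> (1/2) ^ (n div 2)"
  using assms
proof (induction n arbitrary: x rule: less_induct)
  case (less n)
  note y = cf_step_irrational[OF less.prems(1)]
  let ?y = "cf_step x"
  note z = cf_step_irrational[OF y(1)]
  consider "n = 0" | "n = Suc 0" | m where "n = Suc (Suc m)"
    by (metis not0_implies_Suc)
  then show ?case
  proof cases
    case 1
    then show ?thesis
      using less.prems frac_lt_1[of x] frac_ge_0[of x] by (simp add: cf_digit_def frac_def)
  next
    case 2
    have "\<bar>?y - fin_cf (cf_digit ?y) 0\<bar> \<le> 1"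
      using less.IH[of 0 ?y] 2 y by simp
    then have "\<bar>?y - fin_cf (cf_digit ?y) 0\<bar> / ?y \<le> 1"
      using y by (simp add: field_simps)
    then show ?thesis using fin_cf_digit_error_Suc[OF less.prems, of 0] 2 by simp
  next
    case 3
    let ?z = "cf_step ?y"
    have "\<bar>x - fin_cf (cf_digit x) n\<bar> \<le> \<bar>?y - fin_cf (cf_digit ?y) (Suc m)\<bar> / ?y"
      using fin_cf_digit_error_Suc[OF less.prems] unfolding 3 .
    also have "\<dots> \<le> \<bar>?z - fin_cf (cf_digit ?z) m\<bar> / ?z / ?y"
      using fin_cf_digit_error_Suc[of ?y m] y by (intro divide_right_mono) auto
    also have "\<dots> = \<bar>?z - fin_cf (cf_digit ?z) m\<bar> / (?y * ?z)" by simp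
    also have "\<dots> \<le> (1/2) ^ (m div 2) / 2"
      by (intro frac_le less.IH cf_step_mult_ge_2 y z) (use z 3 in auto)
    finally show ?thesis using 3 by simp
  qed
qed

lemma fin_cf_digit_tendsto:
  assumes "x \<notin> \<rat>" "x > 0"
  shows "fin_cf (cf_digit x) \<longlonglongrightarrow> x"
proof -
  have *: "(\<lambda>n. (1/2 :: real) ^ (n div 2)) \<longlonglongrightarrow> 0"
    by (rule filterlim_compose[OF LIMSEQ_power_zero filterlim_at_top_div_const_nat]) auto
  have "(\<lambda>n. fin_cf (cf_digit x) n - x) \<longlonglongrightarrow> 0"
  proof (rule tendsto_0_le[OF *, of _ 1], rule always_eventually, rule allI)
    show "norm (fin_cf (cf_digit x) n - x) \<le> norm ((1/2 :: real) ^ (n div 2)) * 1" for n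
      using fin_cf_digit_error[OF assms, of n] by (simp add: abs_minus_commute)
  qed
  then show ?thesis by (simp add: LIM_zero_iff)
qed

text \<open>Resolves the definite description behind \<open>cf_term\<close>: convergence gives
  existence, peeling off digits gives uniqueness. Digits are floors from here on, which is what
  makes continuity accessible.\<close>

lemma cf_term_eq_digit:
  assumes "\<theta> \<in> {0<..<1} - \<rat>"
  shows "cf_term \<theta> = cf_digit \<theta>"
  unfolding cf_term_def
proof (rule the_equality)
  show "cf_digit \<theta> 0 = 0 \<and> (\<forall>n\<ge>1. cf_digit \<theta> n > 0) \<and> fin_cf (cf_digit \<theta>) \<longlonglongrightarrow> \<theta>"
  proof (intro conjI allI impI)
    show "cf_digit \<theta> 0 = 0"
      using assms floor_eq_iff[of \<theta> 0] by (simp add: cf_digit_def)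
    show "cf_digit \<theta> n > 0" if "n \<ge> 1" for n
      using that assms cf_digit_Suc_pos[of \<theta> "n - 1"] by simp
    show "fin_cf (cf_digit \<theta>) \<longlonglongrightarrow> \<theta>"
      using assms by (intro fin_cf_digit_tendsto) auto
  qed
  show "r = cf_digit \<theta>" if "r 0 = 0 \<and> (\<forall>n\<ge>1. r n > 0) \<and> fin_cf r \<longlonglongrightarrow> \<theta>" for r
    using fin_cf_limit_digit[of r \<theta>] that assms by auto
qed

text \<open>The index is shifted by one: \<open>cf_delta \<theta> (k + 1)\<close> is \<open>\<bar>\<theta> q\<^sub>k - p\<^sub>k\<bar>\<close>, and \<open>cf_delta \<theta> 0\<close>
  belongs to the convention \<open>k = -1\<close>.\<close>

definition cf_delta :: "real \<Rightarrow> nat \<Rightarrow> real" where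
  "cf_delta \<theta> n = (\<Prod>i<n. 1 / cf_quot \<theta> (Suc i))"

lemma cf_delta_pos:
  assumes "\<theta> \<notin> \<rat>"
  shows "cf_delta \<theta> n > 0"
  unfolding cf_delta_def
proof (intro prod_pos)
  show "1 / cf_quot \<theta> (Suc i) > 0" for i
    using cf_quot_Suc_gt_1[OF assms, of i] by simp
qed

lemma cf_delta_Suc_less:
  assumes "\<theta> \<notin> \<rat>"
  shows "cf_delta \<theta> (Suc n) < cf_delta \<theta> n"
  using cf_delta_pos[OF assms, of n] cf_quot_Suc_gt_1[OF assms, of n]
  by (simp add: cf_delta_def divide_less_eq)

text \<open>This is \<open>cf_digit_Suc_eq\<close> multiplied by
  \<open>cf_delta \<theta> (Suc n)\<close>. For N = n + 1 it computes the total weight of r_N large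
  blocks and one second summand.\<close>

lemma cf_delta_rec:
  assumes "\<theta> \<notin> \<rat>"
  shows "cf_delta \<theta> n = real (cf_digit \<theta> (Suc n)) * cf_delta \<theta> (Suc n) + cf_delta \<theta> (Suc (Suc n))"
  using cf_quot_Suc_gt_1[OF assms, of n] cf_quot_Suc_gt_1[OF assms, of "Suc n"]
  by (simp add: cf_digit_Suc_eq[OF assms] cf_delta_def field_simps)

section \<open>Errors of the convergents and the determinant identity\<close>

context
  fixes \<theta> :: real
  assumes \<theta>: "\<theta> \<in> {0<..<1} - \<rat>"
begin

lemma cf_delta_1: "cf_delta \<theta> (Suc 0) = \<theta>"
proof -
  have "\<lfloor>\<theta>\<rfloor> = 0" using \<theta> floor_eq_iff[of \<theta> 0] by simp
  then show ?thesis by (simp add: cf_delta_def cf_quot_Suc cf_step_def frac_def)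
qed

lemma cf_delta_2: "cf_delta \<theta> (Suc (Suc 0)) = 1 - real (cf_term \<theta> (Suc 0)) * \<theta>"
proof -
  have "cf_delta \<theta> 0 = 1" by (simp add: cf_delta_def)
  then show ?thesis
    using cf_delta_rec[of \<theta> 0] \<theta> unfolding cf_term_eq_digit[OF \<theta>] cf_delta_1 by auto
qed

text \<open>The recursion for \<open>cf_delta\<close> subtracts where those for
  \<open>cf_num\<close> and \<open>cf_den\<close> add; the alternating sign reconciles them.\<close>

lemma cf_approx_error:
  "\<theta> * real (cf_den \<theta> n) - real (cf_num \<theta> n) = (-1) ^ n * cf_delta \<theta> (Suc n)"
proof (induction n rule: induct_nat_012)
  case 0
  show ?case by (simp add: cf_delta_1)
next
  case 1
  show ?case by (simp add: cf_delta_2 mult.commute)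
next
  case (ge2 n)
  have "cf_delta \<theta> (Suc n) = real (cf_term \<theta> (Suc (Suc n))) * cf_delta \<theta> (Suc (Suc n))
      + cf_delta \<theta> (Suc (Suc (Suc n)))"
    using cf_delta_rec[of \<theta> "Suc n"] \<theta> cf_term_eq_digit[OF \<theta>] by simp
  moreover have "\<theta> * real (cf_den \<theta> (Suc (Suc n))) - real (cf_num \<theta> (Suc (Suc n)))
     = real (cf_term \<theta> (Suc (Suc n))) * (\<theta> * real (cf_den \<theta> (Suc n)) - real (cf_num \<theta> (Suc n)))
       + (\<theta> * real (cf_den \<theta> n) - real (cf_num \<theta> n))"
    by (simp add: algebra_simps)
  ultimately show ?case unfolding ge2 by (simp add: algebra_simps)
qed

text \<open>In view of \<open>cf_approx_error\<close> this is the determinant identity p_{n+1} q_n -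
  p_n q_{n+1} = (-1)^n. The left side is invariant in n because denominators and errors obey
  mirrored recursions.\<close>

lemma cf_den_delta:
  "real (cf_den \<theta> (Suc n)) * cf_delta \<theta> (Suc n) + real (cf_den \<theta> n) * cf_delta \<theta> (Suc (Suc n)) = 1"
proof (induction n)
  case 0
  show ?case by (simp add: cf_delta_1 cf_delta_2)
next
  case (Suc n)
  have "cf_delta \<theta> (Suc n) = real (cf_term \<theta> (Suc (Suc n))) * cf_delta \<theta> (Suc (Suc n))
      + cf_delta \<theta> (Suc (Suc (Suc n)))"
    using cf_delta_rec[of \<theta> "Suc n"] \<theta> cf_term_eq_digit[OF \<theta>] by simp
  then show ?case using Suc.IH by (simp add: algebra_simps)
qed

lemma cf_term_Suc_pos: "cf_term \<theta> (Suc n) > 0"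
  using \<theta> cf_digit_Suc_pos[of \<theta>] cf_term_eq_digit[OF \<theta>] by simp

lemma cf_den_pos: "cf_den \<theta> n > 0"
  by (induction n rule: induct_nat_012) (use cf_term_Suc_pos[of 0] in simp_all)

text \<open>The two indices differ by two, so both errors have the same sign and it cancels.\<close>

lemma cf_error_quotient:
  "(\<theta> * cf_q \<theta> (int (Suc n)) - cf_p \<theta> (int (Suc n)))
     / ((\<theta> * cf_q \<theta> (int (Suc n) - 2) - cf_p \<theta> (int (Suc n) - 2)) * c * d)
   = cf_delta \<theta> (Suc (Suc n)) / (cf_delta \<theta> n * c * d)"
proof -
  have num: "\<theta> * cf_q \<theta> (int (Suc n)) - cf_p \<theta> (int (Suc n)) = (-1) ^ Suc n * cf_delta \<theta> (Suc (Suc n))"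
    using cf_approx_error[of "Suc n"] by (simp add: cf_q_def cf_p_def nat_add_distrib del: cf_den.simps cf_num.simps)
  have den: "\<theta> * cf_q \<theta> (int (Suc n) - 2) - cf_p \<theta> (int (Suc n) - 2) = (-1) ^ Suc n * cf_delta \<theta> n"
  proof (cases n)
    \<comment> \<open>This is N = 1: the convention p_{-1} = 1, q_{-1} = 0 gives the error -1, which
      fits the pattern because \<open>cf_delta \<theta> 0\<close> is an empty product.\<close>
    case 0
    then show ?thesis by (simp add: cf_q_def cf_p_def cf_delta_def)
  next
    case (Suc m)
    then show ?thesis using cf_approx_error[of m] by (simp add: cf_q_def cf_p_def)
  qed
  show ?thesis unfolding num den mult.assoc by (rule mult_divide_mult_cancel_left) simp
qed

end

section \<open>Continuity in the parameter\<close>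

lemma cf_step_tendsto:
  assumes "(f \<longlongrightarrow> x) F" "x \<notin> \<rat>"
  shows "((\<lambda>n. cf_step (f n)) \<longlongrightarrow> cf_step x) F"
proof -
  have "x \<notin> \<int>" using assms(2) Ints_subset_Rats by auto
  then show ?thesis
    unfolding cf_step_def frac_def using frac_irrational(2)[OF assms(2)]
    by (intro tendsto_divide tendsto_const tendsto_diff tendsto_of_int_floor assms) (auto simp: frac_def)
qed

lemma cf_quot_tendsto:
  assumes "(f \<longlongrightarrow> x) F" "x \<notin> \<rat>"
  shows "((\<lambda>n. cf_quot (f n) k) \<longlongrightarrow> cf_quot x k) F"
  by (induction k) (use assms cf_quot_irrational[OF assms(2)] in \<open>auto simp: cf_quot_Suc intro!: cf_step_tendsto\<close>)

lemma cf_delta_tendsto: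
  assumes "(f \<longlongrightarrow> x) F" "x \<notin> \<rat>"
  shows "((\<lambda>n. cf_delta (f n) k) \<longlongrightarrow> cf_delta x k) F"
  unfolding cf_delta_def
proof (intro tendsto_prod tendsto_divide tendsto_const cf_quot_tendsto assms)
  show "cf_quot x (Suc i) \<noteq> 0" for i
    using cf_quot_Suc_gt_1[OF assms(2), of i] by auto
qed

text \<open>The complete quotient of the limit is irrational, hence not an integer, and the floor is
  locally constant there; so the digit is even eventually constant.\<close>

lemma cf_digit_tendsto:
  assumes "(f \<longlongrightarrow> x) F" "x \<notin> \<rat>"
  shows "((\<lambda>n. real (cf_digit (f n) k)) \<longlongrightarrow> real (cf_digit x k)) F"
proof -
  have "cf_quot x k \<notin> \<int>" using cf_quot_irrational[OF assms(2)] Ints_subset_Rats by blast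
  then have "\<forall>\<^sub>F n in F. \<lfloor>cf_quot (f n) k\<rfloor> = \<lfloor>cf_quot x k\<rfloor>"
    by (intro eventually_floor_eq cf_quot_tendsto assms)
  then show ?thesis
    by (intro tendsto_eventually) (auto simp: cf_digit_def elim: eventually_mono)
qed

lemma cf_error_quotient_tendsto:
  assumes "\<And>n. n \<ge> 1 \<Longrightarrow> \<xi> n \<in> {0<..<1} - \<rat>" "\<phi> \<in> {0<..<1} - \<rat>" "\<xi> \<longlonglongrightarrow> \<phi>"
  shows "(\<lambda>n. (\<xi> n * cf_q (\<xi> n) (int (Suc k)) - cf_p (\<xi> n) (int (Suc k)))
              / ((\<xi> n * cf_q (\<xi> n) (int (Suc k) - 2) - cf_p (\<xi> n) (int (Suc k) - 2))
                 * real (cf_term (\<xi> n) (Suc k)) * (real (cf_term (\<xi> n) (Suc k)) + 1)\<^sup>2))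
        \<longlonglongrightarrow> (\<phi> * cf_q \<phi> (int (Suc k)) - cf_p \<phi> (int (Suc k)))
              / ((\<phi> * cf_q \<phi> (int (Suc k) - 2) - cf_p \<phi> (int (Suc k) - 2))
                 * real (cf_term \<phi> (Suc k)) * (real (cf_term \<phi> (Suc k)) + 1)\<^sup>2)"
    (is "?f \<longlonglongrightarrow> ?l")
proof -
  \<comment> \<open>The quotient with its signs cancelled; every factor of this form is continuous
    at irrational points.\<close>
  define g where "g x = cf_delta x (Suc (Suc k))
    / (cf_delta x k * real (cf_digit x (Suc k)) * (real (cf_digit x (Suc k)) + 1)\<^sup>2)" for x
  have irr: "\<phi> \<notin> \<rat>" using assms(2) by simp
  have lim: "(\<lambda>n. g (\<xi> n)) \<longlonglongrightarrow> g \<phi>"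
    unfolding g_def
    by (rule tendsto_divide tendsto_mult tendsto_power tendsto_add tendsto_const
        cf_delta_tendsto[OF assms(3) irr] cf_digit_tendsto[OF assms(3) irr])+
      (use cf_delta_pos[OF irr, of k] cf_digit_Suc_pos[OF irr, of k] in \<open>auto simp: add_eq_0_iff\<close>)
  have "g \<phi> = ?l"
    unfolding cf_error_quotient[OF assms(2)] g_def cf_term_eq_digit[OF assms(2)] ..
  \<comment> \<open>\<open>\<xi> 0\<close> is unconstrained, so the rewriting into complete
    quotients is available only from index 1 on.\<close>
  moreover have "\<forall>\<^sub>F n in sequentially. g (\<xi> n) = ?f n"
    using eventually_ge_at_top[of 1]
  proof eventually_elim
    case (elim n)
    note \<xi> = assms(1)[OF elim]
    show ?case unfolding cf_error_quotient[OF \<xi>] g_def cf_term_eq_digit[OF \<xi>] ..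
  qed
  ultimately show ?thesis using Lim_transform_eventually[OF lim] by simp
qed

section \<open>Operator norms of complex matrices\<close>

lemma vec_l2norm_nonneg [simp]: "0 \<le> vec_l2norm v"
  by (simp add: vec_l2norm_def L2_set_nonneg)

lemma vec_l2norm_power2: "(vec_l2norm v)\<^sup>2 = (\<Sum>i<dim_vec v. (cmod (v $ i))\<^sup>2)"
  by (simp add: vec_l2norm_def L2_set_def sum_nonneg)

lemma vec_l2norm_smult: "vec_l2norm (c \<cdot>\<^sub>v v) = cmod c * vec_l2norm v"
  unfolding vec_l2norm_def
  by (subst L2_set_right_distrib) (auto simp: norm_mult intro!: L2_set_cong)

lemma vec_l2norm_triangle:
  assumes "u \<in> carrier_vec n" "v \<in> carrier_vec n"
  shows "vec_l2norm (u + v) \<le> vec_l2norm u + vec_l2norm v"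
proof -
  have "vec_l2norm (u + v) \<le> L2_set (\<lambda>i. cmod (u $ i) + cmod (v $ i)) {..<n}"
    unfolding vec_l2norm_def using assms by (auto intro!: L2_set_mono norm_triangle_ineq)
  also have "\<dots> \<le> vec_l2norm u + vec_l2norm v"
    unfolding vec_l2norm_def using assms by (auto intro: L2_set_triangle_ineq)
  finally show ?thesis .
qed

lemma vec_l2norm_0 [simp]: "vec_l2norm (0\<^sub>v n) = 0"
  by (simp add: vec_l2norm_def L2_set_def)

lemma vec_l2norm_eq_0:
  assumes "v \<in> carrier_vec n" "vec_l2norm v = 0"
  shows "v = 0\<^sub>v n"
  using assms by (intro eq_vecI) (auto simp: vec_l2norm_def L2_set_eq_0_iff)

lemma cscalar_prod_sum:
  assumes "u \<in> carrier_vec n" "v \<in> carrier_vec n"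
  shows "u \<bullet>c v = (\<Sum>i<n. u $ i * cnj (v $ i))"
  using assms by (simp add: scalar_prod_def atLeast0LessThan)

lemma cscalar_prod_self: "v \<bullet>c v = complex_of_real ((vec_l2norm v)\<^sup>2)"
  by (simp add: cscalar_prod_sum[of _ "dim_vec v"] vec_l2norm_power2 complex_norm_square
      del: of_real_power)

lemma cscalar_prod_cauchy_schwarz:
  assumes "u \<in> carrier_vec n" "v \<in> carrier_vec n"
  shows "cmod (u \<bullet>c v) \<le> vec_l2norm u * vec_l2norm v"
proof -
  have "cmod (u \<bullet>c v) \<le> (\<Sum>i<n. cmod (u $ i) * cmod (v $ i))"
    unfolding cscalar_prod_sum[OF assms] by (rule sum_norm_le) (simp add: norm_mult)
  also have "\<dots> \<le> vec_l2norm u * vec_l2norm v"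
    using L2_set_mult_ineq[of "\<lambda>i. cmod (u $ i)" "\<lambda>i. cmod (v $ i)" "{..<n}"] assms
    by (simp add: vec_l2norm_def)
  finally show ?thesis .
qed

lemma cscalar_prod_diff:
  fixes u v :: "complex vec"
  assumes "u \<in> carrier_vec n" "v \<in> carrier_vec n"
  shows "(v - u) \<bullet>c (v - u) = v \<bullet>c v - u \<bullet>c v - v \<bullet>c u + u \<bullet>c u"
  using assms
  by (simp add: scalar_prod_def sum_subtractf[symmetric] sum.distrib[symmetric] algebra_simps)

lemma mult_mat_vec_index:
  assumes "A \<in> carrier_mat n m" "v \<in> carrier_vec m" "i < n"
  shows "(A *\<^sub>v v) $ i = (\<Sum>j<m. A $$ (i, j) * v $ j)"
  using assms by (simp add: scalar_prod_def atLeast0LessThan)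

lemma mult_mat_index:
  assumes "A \<in> carrier_mat n m" "B \<in> carrier_mat m l" "i < n" "j < l"
  shows "(A * B) $$ (i, j) = (\<Sum>k<m. A $$ (i, k) * B $$ (k, j))"
  using assms by (simp add: scalar_prod_def atLeast0LessThan)

lemma mat_adjoint_index:
  assumes "A \<in> carrier_mat n m" "i < m" "j < n"
  shows "mat_adjoint A $$ (i, j) = cnj (A $$ (j, i))"
  using assms by (simp add: mat_adjoint_def mat_of_rows_index)

lemma mat_adjoint_carrier [simp]:
  "A \<in> carrier_mat n m \<Longrightarrow> mat_adjoint A \<in> carrier_mat m n"
  by (simp add: mat_adjoint_def mat_of_rows_def)

lemma mat_adjoint_dim [simp]:
  "dim_row (mat_adjoint A) = dim_col A" "dim_col (mat_adjoint A) = dim_row A"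
  by (simp_all add: mat_adjoint_def)

lemma mat_adjoint_adjoint:
  assumes "(A :: complex mat) \<in> carrier_mat n m"
  shows "mat_adjoint (mat_adjoint A) = A"
proof (rule eq_matI)
  have c: "mat_adjoint A \<in> carrier_mat m n" using assms by simp
  show "dim_row (mat_adjoint (mat_adjoint A)) = dim_row A"
    "dim_col (mat_adjoint (mat_adjoint A)) = dim_col A" by simp_all
  show "mat_adjoint (mat_adjoint A) $$ (i, j) = A $$ (i, j)" if "i < dim_row A" "j < dim_col A" for i j
    using that assms mat_adjoint_index[OF c, of i j] mat_adjoint_index[OF assms, of j i] by simp
qed

lemma cscalar_prod_adjoint:
  assumes A: "(A :: complex mat) \<in> carrier_mat n m" and u: "u \<in> carrier_vec n" and v: "v \<in> carrier_vec m"
  shows "(A *\<^sub>v v) \<bullet>c u = v \<bullet>c (mat_adjoint A *\<^sub>v u)"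
proof -
  have "(A *\<^sub>v v) \<bullet>c u = (\<Sum>i<n. \<Sum>j<m. A $$ (i, j) * v $ j * cnj (u $ i))"
    using A u v by (subst cscalar_prod_sum[of _ n])
      (auto simp: mult_mat_vec_index[OF A v] sum_distrib_right simp del: index_mult_mat_vec)
  also have "\<dots> = (\<Sum>j<m. \<Sum>i<n. A $$ (i, j) * v $ j * cnj (u $ i))"
    by (rule sum.swap)
  also have "\<dots> = (\<Sum>j<m. v $ j * cnj ((mat_adjoint A *\<^sub>v u) $ j))"
    by (intro sum.cong refl)
      (simp add: mult_mat_vec_index[OF mat_adjoint_carrier[OF A] u] mat_adjoint_index[OF A]
        sum_distrib_left mult_ac del: index_mult_mat_vec)
  also have "\<dots> = v \<bullet>c (mat_adjoint A *\<^sub>v u)"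
    using mult_mat_vec_carrier[OF mat_adjoint_carrier[OF A] u] v by (simp add: cscalar_prod_sum)
  finally show ?thesis .
qed

text \<open>A crude entrywise bound, whose purpose is to show that the supremum in
  \<open>mat_opnorm\<close> is taken over a bounded set; without that a real supremum carries no
  information.\<close>

lemma mult_mat_vec_bounded:
  assumes A: "A \<in> carrier_mat n m" and v: "v \<in> carrier_vec m" "vec_l2norm v \<le> 1"
  shows "vec_l2norm (A *\<^sub>v v) \<le> (\<Sum>i<n. \<Sum>j<m. cmod (A $$ (i, j)))"
proof -
  have vj: "cmod (v $ j) \<le> 1" if "j < m" for j
    using member_le_L2_set[of "{..<m}" j "\<lambda>j. cmod (v $ j)"] that v
    by (simp add: vec_l2norm_def)
  have "vec_l2norm (A *\<^sub>v v) \<le> (\<Sum>i<n. cmod ((A *\<^sub>v v) $ i))"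
    using L2_set_le_sum[of "{..<n}" "\<lambda>i. cmod ((A *\<^sub>v v) $ i)"] A by (simp add: vec_l2norm_def)
  also have "\<dots> \<le> (\<Sum>i<n. \<Sum>j<m. cmod (A $$ (i, j)))"
  proof (rule sum_mono)
    fix i assume "i \<in> {..<n}"
    then have "cmod ((A *\<^sub>v v) $ i) \<le> (\<Sum>j<m. cmod (A $$ (i, j)) * cmod (v $ j))"
      by (simp add: mult_mat_vec_index[OF A v(1)] sum_norm_le norm_mult del: index_mult_mat_vec)
    also have "\<dots> \<le> (\<Sum>j<m. cmod (A $$ (i, j)))"
      using vj by (intro sum_mono mult_left_le) auto
    finally show "cmod ((A *\<^sub>v v) $ i) \<le> (\<Sum>j<m. cmod (A $$ (i, j)))" .
  qed
  finally show ?thesis .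
qed

lemma mat_opnorm_bound_unit:
  assumes A: "A \<in> carrier_mat n m" and v: "v \<in> carrier_vec m" "vec_l2norm v \<le> 1"
  shows "vec_l2norm (A *\<^sub>v v) \<le> mat_opnorm A"
proof -
  have "bdd_above ((\<lambda>v. vec_l2norm (A *\<^sub>v v)) ` {v \<in> carrier_vec m. vec_l2norm v \<le> 1})"
    using mult_mat_vec_bounded[OF A] by (auto intro!: bdd_aboveI2)
  then show ?thesis
    unfolding mat_opnorm_def using A v by (intro cSUP_upper) auto
qed

lemma mat_opnorm_nonneg: "0 \<le> mat_opnorm A"
proof -
  have "vec_l2norm (A *\<^sub>v 0\<^sub>v (dim_col A)) \<le> mat_opnorm A"
    by (rule mat_opnorm_bound_unit) auto
  then show ?thesis using vec_l2norm_nonneg order.trans by blast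
qed

lemma mat_opnorm_bound:
  assumes A: "A \<in> carrier_mat n m" and v: "v \<in> carrier_vec m"
  shows "vec_l2norm (A *\<^sub>v v) \<le> mat_opnorm A * vec_l2norm v"
proof (cases "vec_l2norm v = 0")
  case True
  have "A *\<^sub>v v = 0\<^sub>v n"
    using vec_l2norm_eq_0[OF v True] A by auto
  then show ?thesis using True by simp
next
  case False
  define c where "c = complex_of_real (1 / vec_l2norm v)"
  have c: "cmod c = 1 / vec_l2norm v" by (simp add: c_def norm_divide)
  have "vec_l2norm (A *\<^sub>v (c \<cdot>\<^sub>v v)) \<le> mat_opnorm A"
    using False v c by (intro mat_opnorm_bound_unit[OF A]) (auto simp: vec_l2norm_smult)
  then have "vec_l2norm (A *\<^sub>v v) / vec_l2norm v \<le> mat_opnorm A"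
    using A v c by (simp add: mult_mat_vec[OF A v] vec_l2norm_smult)
  moreover have "0 < vec_l2norm v" using False vec_l2norm_nonneg[of v] by linarith
  ultimately show ?thesis by (simp add: divide_le_eq)
qed

lemma mat_opnorm_leI:
  assumes A: "A \<in> carrier_mat n m" and K: "0 \<le> K"
    and le: "\<And>v. v \<in> carrier_vec m \<Longrightarrow> vec_l2norm (A *\<^sub>v v) \<le> K * vec_l2norm v"
  shows "mat_opnorm A \<le> K"
  unfolding mat_opnorm_def
proof (rule cSUP_least)
  show "{v \<in> carrier_vec (dim_col A). vec_l2norm v \<le> 1} \<noteq> {}"
    by (auto intro!: exI[of _ "0\<^sub>v (dim_col A)"])
  fix v assume "v \<in> {v \<in> carrier_vec (dim_col A). vec_l2norm v \<le> 1}"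
  then have v: "v \<in> carrier_vec m" "vec_l2norm v \<le> 1" using A by auto
  show "vec_l2norm (A *\<^sub>v v) \<le> K"
    using le[OF v(1)] mult_left_le[OF v(2) K] by linarith
qed

lemma smult_mat_mult_vec:
  assumes "A \<in> carrier_mat n m" "v \<in> carrier_vec m"
  shows "(c \<cdot>\<^sub>m A) *\<^sub>v v = c \<cdot>\<^sub>v (A *\<^sub>v v)"
proof (rule eq_vecI)
  show "dim_vec ((c \<cdot>\<^sub>m A) *\<^sub>v v) = dim_vec (c \<cdot>\<^sub>v (A *\<^sub>v v))" by simp
  fix i assume "i < dim_vec (c \<cdot>\<^sub>v (A *\<^sub>v v))"
  then show "((c \<cdot>\<^sub>m A) *\<^sub>v v) $ i = (c \<cdot>\<^sub>v (A *\<^sub>v v)) $ i"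
    using assms by (simp add: scalar_prod_def sum_distrib_left mult.assoc)
qed

lemma mat_opnorm_mult:
  assumes A: "A \<in> carrier_mat n m" and B: "B \<in> carrier_mat m l"
  shows "mat_opnorm (A * B) \<le> mat_opnorm A * mat_opnorm B"
proof (rule mat_opnorm_leI)
  show "A * B \<in> carrier_mat n l" using A B by simp
  show "0 \<le> mat_opnorm A * mat_opnorm B" by (simp add: mat_opnorm_nonneg)
  fix v :: "complex vec" assume v: "v \<in> carrier_vec l"
  have "vec_l2norm ((A * B) *\<^sub>v v) \<le> mat_opnorm A * vec_l2norm (B *\<^sub>v v)"
    unfolding assoc_mult_mat_vec[OF A B v]
    using B v by (intro mat_opnorm_bound[OF A]) auto
  also have "\<dots> \<le> mat_opnorm A * (mat_opnorm B * vec_l2norm v)"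
    by (intro mult_left_mono mat_opnorm_bound[OF B v] mat_opnorm_nonneg)
  finally show "vec_l2norm ((A * B) *\<^sub>v v) \<le> mat_opnorm A * mat_opnorm B * vec_l2norm v"
    by (simp add: mult.assoc)
qed

text \<open>For w = \<open>A^* u\<close> the squared norm of w is <A w, u>; Cauchy-Schwarz applies,
  and one factor of the norm of w cancels.\<close>

lemma mat_opnorm_adjoint:
  assumes A: "A \<in> carrier_mat n m"
  shows "mat_opnorm (mat_adjoint A) \<le> mat_opnorm A"
proof (rule mat_opnorm_leI)
  show A': "mat_adjoint A \<in> carrier_mat m n" using A by simp
  show "0 \<le> mat_opnorm A" by (simp add: mat_opnorm_nonneg)
  fix u :: "complex vec" assume u: "u \<in> carrier_vec n"
  let ?w = "mat_adjoint A *\<^sub>v u"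
  have w: "?w \<in> carrier_vec m" using A' u by simp
  have "(vec_l2norm ?w)\<^sup>2 = cmod (?w \<bullet>c ?w)"
    by (simp only: cscalar_prod_self norm_of_real) simp
  also have "\<dots> = cmod ((A *\<^sub>v ?w) \<bullet>c u)"
    by (simp only: cscalar_prod_adjoint[OF A u w])
  also have "\<dots> \<le> vec_l2norm (A *\<^sub>v ?w) * vec_l2norm u"
    using A w u by (intro cscalar_prod_cauchy_schwarz) auto
  also have "\<dots> \<le> (mat_opnorm A * vec_l2norm ?w) * vec_l2norm u"
    by (intro mult_right_mono mat_opnorm_bound[OF A w]) simp
  finally have "vec_l2norm ?w * vec_l2norm ?w \<le> vec_l2norm ?w * (mat_opnorm A * vec_l2norm u)"
    by (simp add: power2_eq_square mult_ac)
  then show "vec_l2norm ?w \<le> mat_opnorm A * vec_l2norm u"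
    using mat_opnorm_nonneg[of A] vec_l2norm_nonneg[of ?w]
    by (cases "vec_l2norm ?w = 0") (auto simp: mult_le_cancel_left)
qed

text \<open>The way back from \<open>a^* a\<close> to a: a bound on a diagonal block of
  \<open>a^* a\<close> becomes a bound on a for vectors in that block. With a projection as A it
  also turns traces of projections into sums of squares.\<close>

lemma cscalar_prod_gram:
  assumes A: "A \<in> carrier_mat n m" and v: "v \<in> carrier_vec m"
  shows "((mat_adjoint A * A) *\<^sub>v v) \<bullet>c v = complex_of_real ((vec_l2norm (A *\<^sub>v v))\<^sup>2)"
proof -
  note A' = mat_adjoint_carrier[OF A]
  have Av: "A *\<^sub>v v \<in> carrier_vec n" using A v by simp
  have "((mat_adjoint A * A) *\<^sub>v v) \<bullet>c v = (mat_adjoint A *\<^sub>v (A *\<^sub>v v)) \<bullet>c v"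
    by (simp only: assoc_mult_mat_vec[OF A' A v])
  also have "\<dots> = (A *\<^sub>v v) \<bullet>c (A *\<^sub>v v)"
    by (simp only: cscalar_prod_adjoint[OF A' v Av] mat_adjoint_adjoint[OF A])
  finally show ?thesis by (simp only: cscalar_prod_self)
qed

section \<open>Projections and traces\<close>

definition proj_mat :: "nat \<Rightarrow> complex mat \<Rightarrow> bool" where
  "proj_mat n E \<longleftrightarrow> E \<in> carrier_mat n n \<and> mat_adjoint E = E \<and> E * E = E"

lemma proj_mat_l2norm:
  assumes E: "proj_mat n E" and v: "v \<in> carrier_vec n"
  shows "(vec_l2norm (E *\<^sub>v v))\<^sup>2 + (vec_l2norm ((1\<^sub>m n - E) *\<^sub>v v))\<^sup>2 = (vec_l2norm v)\<^sup>2"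
proof -
  have c: "E \<in> carrier_mat n n" using E by (simp add: proj_mat_def)
  let ?u = "E *\<^sub>v v" and ?w = "(1\<^sub>m n - E) *\<^sub>v v"
  have u: "?u \<in> carrier_vec n" and w: "?w \<in> carrier_vec n"
    using mult_mat_vec_carrier[OF c v] mult_mat_vec_carrier[OF minus_carrier_mat[OF c] v] by auto
  have w_eq: "?w = v - ?u"
    using c v by (simp add: minus_mult_distrib_mat_vec[of _ n n])
  have uu: "?u \<bullet>c ?u = v \<bullet>c ?u"
    using cscalar_prod_adjoint[OF c u v] E assoc_mult_mat_vec[OF c c v] by (simp add: proj_mat_def)
  have vu: "v \<bullet>c ?u = ?u \<bullet>c v"
    using cscalar_prod_adjoint[OF c v v] E by (simp add: proj_mat_def)
  have "?w \<bullet>c ?w = v \<bullet>c v - ?u \<bullet>c v - v \<bullet>c ?u + ?u \<bullet>c ?u"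
    unfolding w_eq by (rule cscalar_prod_diff[OF u v])
  then have "?u \<bullet>c ?u + ?w \<bullet>c ?w = v \<bullet>c v"
    using uu vu by simp
  then show ?thesis
    unfolding cscalar_prod_self by (simp only: of_real_add[symmetric] of_real_eq_iff)
qed

lemma cauchy_schwarz_pair:
  fixes a b x y :: real
  shows "a * x + b * y \<le> sqrt (a\<^sup>2 + b\<^sup>2) * sqrt (x\<^sup>2 + y\<^sup>2)"
proof -
  have "0 \<le> (a * y - b * x)\<^sup>2" by simp
  then have "(a * x + b * y)\<^sup>2 \<le> (a\<^sup>2 + b\<^sup>2) * (x\<^sup>2 + y\<^sup>2)"
    by (simp add: power2_eq_square algebra_simps)
  then show ?thesis
    unfolding real_sqrt_mult[symmetric] by (rule real_le_rsqrt)
qed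

text \<open>\<open>E v\<close> and \<open>(1 - E) v\<close> are orthogonal, so Cauchy-Schwarz for
  the pair (1, |c| norm A) applies and the bound exceeds 1 only to second order in c. The plain
  triangle inequality would leave a linear term, too weak for the uniqueness argument.\<close>

lemma proj_mat_perturb_opnorm:
  assumes E: "proj_mat n E" and A: "A \<in> carrier_mat n n"
  shows "mat_opnorm (E + c \<cdot>\<^sub>m (A * (1\<^sub>m n - E))) \<le> sqrt (1 + (cmod c)\<^sup>2 * (mat_opnorm A)\<^sup>2)"
proof (rule mat_opnorm_leI)
  have Ec: "E \<in> carrier_mat n n" using E by (simp add: proj_mat_def)
  define F where "F = 1\<^sub>m n - E"
  have Fc: "F \<in> carrier_mat n n" unfolding F_def by (rule minus_carrier_mat[OF Ec])
  show "E + c \<cdot>\<^sub>m (A * (1\<^sub>m n - E)) \<in> carrier_mat n n" using Ec Fc A by (simp flip: F_def)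
  show "0 \<le> sqrt (1 + (cmod c)\<^sup>2 * (mat_opnorm A)\<^sup>2)" by simp
  fix v :: "complex vec" assume v: "v \<in> carrier_vec n"
  have "(E + c \<cdot>\<^sub>m (A * F)) *\<^sub>v v = E *\<^sub>v v + c \<cdot>\<^sub>v (A *\<^sub>v (F *\<^sub>v v))"
    using Ec Fc A v
    by (simp add: add_mult_distrib_mat_vec[of _ n n] smult_mat_mult_vec[of _ n n])
  then have "vec_l2norm ((E + c \<cdot>\<^sub>m (A * F)) *\<^sub>v v)
      \<le> vec_l2norm (E *\<^sub>v v) + vec_l2norm (c \<cdot>\<^sub>v (A *\<^sub>v (F *\<^sub>v v)))"
    using Ec Fc A v by (simp only:) (rule vec_l2norm_triangle[of _ n]; simp)
  also have "vec_l2norm (c \<cdot>\<^sub>v (A *\<^sub>v (F *\<^sub>v v))) \<le> (cmod c * mat_opnorm A) * vec_l2norm (F *\<^sub>v v)"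
    using mat_opnorm_bound[OF A, of "F *\<^sub>v v"] Fc v
    by (simp add: vec_l2norm_smult mult.assoc mult_left_mono)
  also have "vec_l2norm (E *\<^sub>v v) + (cmod c * mat_opnorm A) * vec_l2norm (F *\<^sub>v v)
    = 1 * vec_l2norm (E *\<^sub>v v) + (cmod c * mat_opnorm A) * vec_l2norm (F *\<^sub>v v)" by simp
  also have "\<dots> \<le> sqrt (1\<^sup>2 + (cmod c * mat_opnorm A)\<^sup>2)
      * sqrt ((vec_l2norm (E *\<^sub>v v))\<^sup>2 + (vec_l2norm (F *\<^sub>v v))\<^sup>2)"
    by (rule cauchy_schwarz_pair)
  also have "(vec_l2norm (E *\<^sub>v v))\<^sup>2 + (vec_l2norm (F *\<^sub>v v))\<^sup>2 = (vec_l2norm v)\<^sup>2"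
    unfolding F_def by (rule proj_mat_l2norm[OF E v])
  finally show "vec_l2norm ((E + c \<cdot>\<^sub>m (A * (1\<^sub>m n - E))) *\<^sub>v v)
      \<le> sqrt (1 + (cmod c)\<^sup>2 * (mat_opnorm A)\<^sup>2) * vec_l2norm v"
    by (simp add: F_def power_mult_distrib)
qed

lemma mat_tr_mult_commute:
  assumes A: "A \<in> carrier_mat n m" and B: "B \<in> carrier_mat m n"
  shows "mat_tr (A * B) = mat_tr (B * A)"
proof -
  have "mat_tr (A * B) = (\<Sum>i<n. \<Sum>k<m. A $$ (i, k) * B $$ (k, i))"
    using A B by (simp add: mat_tr_def mult_mat_index[OF A B] del: index_mult_mat(1))
  also have "\<dots> = (\<Sum>k<m. \<Sum>i<n. B $$ (k, i) * A $$ (i, k))"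
    by (subst sum.swap) (simp add: mult.commute)
  also have "\<dots> = mat_tr (B * A)"
    using A B by (simp add: mat_tr_def mult_mat_index[OF B A] del: index_mult_mat(1))
  finally show ?thesis .
qed

lemma mat_tr_sum_cscalar_prod:
  assumes A: "A \<in> carrier_mat n n"
  shows "mat_tr A = (\<Sum>i<n. (A *\<^sub>v unit_vec n i) \<bullet>c unit_vec n i)"
proof -
  have "(A *\<^sub>v unit_vec n i) \<bullet>c unit_vec n i = A $$ (i, i)" if "i < n" for i
  proof -
    have "conjugate (unit_vec n i) = (unit_vec n i :: complex vec)"
      by (rule eq_vecI) (auto simp: unit_vec_def)
    then show ?thesis using A that by simp
  qed
  then show ?thesis using A by (simp add: mat_tr_def)
qed

text \<open>By idempotence and cyclicity tr(E A) = tr(E A E), whose i-th diagonal entry is <A E e_i,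
  E e_i>. Each entry is at most norm A times |E e_i|^2, and these squares add up to tr E.\<close>

lemma mat_tr_proj_mult:
  assumes E: "proj_mat n E" and A: "A \<in> carrier_mat n n"
  shows "cmod (mat_tr (E * A)) \<le> Re (mat_tr E) * mat_opnorm A"
    and "mat_tr E = complex_of_real (Re (mat_tr E))" "0 \<le> Re (mat_tr E)"
proof -
  have c: "E \<in> carrier_mat n n" and adj: "mat_adjoint E = E" and idem: "E * E = E"
    using E by (auto simp: proj_mat_def)
  let ?e = "unit_vec n :: nat \<Rightarrow> complex vec"
  have Ee: "E *\<^sub>v ?e i \<in> carrier_vec n" for i using c by simp
  have "mat_tr E = (\<Sum>i<n. complex_of_real ((vec_l2norm (E *\<^sub>v ?e i))\<^sup>2))"
    using cscalar_prod_gram[OF c] by (simp add: mat_tr_sum_cscalar_prod[OF c] adj idem)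
  then have tr: "mat_tr E = complex_of_real (\<Sum>i<n. (vec_l2norm (E *\<^sub>v ?e i))\<^sup>2)"
    by simp
  then show "mat_tr E = complex_of_real (Re (mat_tr E))" by simp
  show "0 \<le> Re (mat_tr E)" by (simp add: tr sum_nonneg)
  have "mat_tr (E * A) = mat_tr (E * (E * A))"
    using c A idem by (simp add: assoc_mult_mat[symmetric, of _ n n _ n _ n])
  also have "\<dots> = mat_tr (E * A * E)"
    using c A by (intro mat_tr_mult_commute[of _ n n]) auto
  also have "\<dots> = (\<Sum>i<n. (E * A * E *\<^sub>v ?e i) \<bullet>c ?e i)"
    using c A by (intro mat_tr_sum_cscalar_prod) auto
  also have "\<dots> = (\<Sum>i<n. (A *\<^sub>v (E *\<^sub>v ?e i)) \<bullet>c (E *\<^sub>v ?e i))"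
  proof (rule sum.cong[OF refl])
    fix i
    have "E * A * E *\<^sub>v ?e i = E *\<^sub>v (A *\<^sub>v (E *\<^sub>v ?e i))"
      using c A by (simp add: assoc_mult_mat_vec[of _ n n _ n])
    then show "(E * A * E *\<^sub>v ?e i) \<bullet>c ?e i = (A *\<^sub>v (E *\<^sub>v ?e i)) \<bullet>c (E *\<^sub>v ?e i)"
      using cscalar_prod_adjoint[OF c, of "?e i" "A *\<^sub>v (E *\<^sub>v ?e i)"] A Ee[of i] by (simp add: adj)
  qed
  finally have "cmod (mat_tr (E * A)) \<le> (\<Sum>i<n. cmod ((A *\<^sub>v (E *\<^sub>v ?e i)) \<bullet>c (E *\<^sub>v ?e i)))"
    by (simp add: norm_sum)
  also have "\<dots> \<le> (\<Sum>i<n. mat_opnorm A * (vec_l2norm (E *\<^sub>v ?e i))\<^sup>2)"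
  proof (rule sum_mono)
    fix i
    have "cmod ((A *\<^sub>v (E *\<^sub>v ?e i)) \<bullet>c (E *\<^sub>v ?e i)) \<le> vec_l2norm (A *\<^sub>v (E *\<^sub>v ?e i)) * vec_l2norm (E *\<^sub>v ?e i)"
      using A Ee[of i] by (intro cscalar_prod_cauchy_schwarz[of _ n]) auto
    also have "\<dots> \<le> mat_opnorm A * vec_l2norm (E *\<^sub>v ?e i) * vec_l2norm (E *\<^sub>v ?e i)"
      by (intro mult_right_mono mat_opnorm_bound[OF A Ee]) simp
    finally show "cmod ((A *\<^sub>v (E *\<^sub>v ?e i)) \<bullet>c (E *\<^sub>v ?e i)) \<le> mat_opnorm A * (vec_l2norm (E *\<^sub>v ?e i))\<^sup>2"
      by (simp add: power2_eq_square mult.assoc)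
  qed
  also have "\<dots> = Re (mat_tr E) * mat_opnorm A"
    by (simp add: tr sum_distrib_left mult.commute)
  finally show "cmod (mat_tr (E * A)) \<le> Re (mat_tr E) * mat_opnorm A" .
qed

section \<open>Block diagonal matrices\<close>

lemma sum_lessThan_add:
  fixes f :: "nat \<Rightarrow> 'a :: comm_monoid_add"
  shows "(\<Sum>i<n + m. f i) = (\<Sum>i<n. f i) + (\<Sum>i<m. f (n + i))"
  by (induction m) (simp_all add: add.assoc)

lemma sum_lessThan_blocks:
  fixes f :: "nat \<Rightarrow> 'a :: comm_monoid_add"
  shows "(\<Sum>i<r * m. f i) = (\<Sum>\<beta><r. \<Sum>a<m. f (\<beta> * m + a))"
proof (induction r)
  case (Suc r)
  have "(\<Sum>i<Suc r * m. f i) = (\<Sum>i<r * m + m. f i)" by (simp add: add.commute)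
  then show ?case by (simp only: sum_lessThan_add Suc.IH sum.lessThan_Suc)
qed simp

lemma sum_supported_interval:
  fixes f :: "nat \<Rightarrow> 'a :: comm_monoid_add"
  assumes "p + l \<le> n" and "\<And>j. j < n \<Longrightarrow> \<not> (p \<le> j \<and> j < p + l) \<Longrightarrow> f j = 0"
  shows "(\<Sum>j<n. f j) = (\<Sum>b<l. f (p + b))"
proof -
  have "(\<Sum>j<n. f j) = (\<Sum>j<p + l + (n - p - l). f j)" using assms(1) by simp
  also have "\<dots> = (\<Sum>b<l. f (p + b))"
    unfolding sum_lessThan_add using assms(1) by (simp add: assms(2))
  finally show ?thesis .
qed

definition inj_vec :: "nat \<Rightarrow> nat \<Rightarrow> complex vec \<Rightarrow> complex vec" where
  "inj_vec n p u = vec n (\<lambda>j. if p \<le> j \<and> j < p + dim_vec u then u $ (j - p) else 0)"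

lemma inj_vec_carrier [simp]: "inj_vec n p u \<in> carrier_vec n"
  by (simp add: inj_vec_def)

lemma inj_vec_dim [simp]: "dim_vec (inj_vec n p u) = n"
  by (simp add: inj_vec_def)

lemma inj_vec_l2norm:
  assumes "p + dim_vec u \<le> n"
  shows "vec_l2norm (inj_vec n p u) = vec_l2norm u"
proof -
  have "(vec_l2norm (inj_vec n p u))\<^sup>2 = (\<Sum>b<dim_vec u. (cmod (inj_vec n p u $ (p + b)))\<^sup>2)"
    unfolding vec_l2norm_power2 inj_vec_dim
    by (rule sum_supported_interval[OF assms]) (auto simp: inj_vec_def)
  also have "\<dots> = (vec_l2norm u)\<^sup>2"
    unfolding vec_l2norm_power2 using assms by (intro sum.cong) (auto simp: inj_vec_def)
  finally show ?thesis by (simp add: power2_eq_iff_nonneg)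
qed

lemma cscalar_prod_mult_mat_vec:
  assumes A: "A \<in> carrier_mat n m" and u: "u \<in> carrier_vec m" and w: "w \<in> carrier_vec n"
  shows "(A *\<^sub>v u) \<bullet>c w = (\<Sum>a<n. \<Sum>b<m. A $$ (a, b) * u $ b * cnj (w $ a))"
  using A u w
  by (subst cscalar_prod_sum[of _ n])
    (auto simp: mult_mat_vec_index[OF A u] sum_distrib_right simp del: index_mult_mat_vec)

text \<open>Diagonal blocks are treated as the form of A on vectors supported in them; norm bounds
  then pass to blocks because \<open>inj_vec\<close> is isometric.\<close>

lemma cscalar_prod_inj_vec:
  assumes A: "A \<in> carrier_mat n n" and u: "u \<in> carrier_vec l" and w: "w \<in> carrier_vec l"
    and pl: "p + l \<le> n"
  shows "(A *\<^sub>v inj_vec n p u) \<bullet>c inj_vec n p w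
    = (\<Sum>a<l. \<Sum>b<l. A $$ (p + a, p + b) * u $ b * cnj (w $ a))"
proof -
  let ?u = "inj_vec n p u" and ?w = "inj_vec n p w"
  have "(A *\<^sub>v ?u) \<bullet>c ?w = (\<Sum>i<n. \<Sum>j<n. A $$ (i, j) * ?u $ j * cnj (?w $ i))"
    by (rule cscalar_prod_mult_mat_vec[OF A]) auto
  also have "\<dots> = (\<Sum>a<l. \<Sum>j<n. A $$ (p + a, j) * ?u $ j * cnj (?w $ (p + a)))"
    by (rule sum_supported_interval[OF pl]) (use w in \<open>auto simp: inj_vec_def\<close>)
  also have "\<dots> = (\<Sum>a<l. \<Sum>b<l. A $$ (p + a, p + b) * ?u $ (p + b) * cnj (?w $ (p + a)))"
    by (intro sum.cong refl sum_supported_interval[OF pl]) (use u in \<open>auto simp: inj_vec_def\<close>)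
  also have "\<dots> = (\<Sum>a<l. \<Sum>b<l. A $$ (p + a, p + b) * u $ b * cnj (w $ a))"
    using u w pl by (intro sum.cong refl) (auto simp: inj_vec_def)
  finally show ?thesis .
qed

text \<open>Test with w = A u. Sesquilinear forms are the convenient handle, since compressions and
  averages act on them linearly.\<close>

lemma mat_opnorm_leI_cscalar_prod:
  assumes A: "A \<in> carrier_mat n m" and K: "0 \<le> K"
    and le: "\<And>u w. u \<in> carrier_vec m \<Longrightarrow> w \<in> carrier_vec n \<Longrightarrow>
      cmod ((A *\<^sub>v u) \<bullet>c w) \<le> K * (vec_l2norm u * vec_l2norm w)"
  shows "mat_opnorm A \<le> K"
proof (rule mat_opnorm_leI[OF A K])
  fix u :: "complex vec" assume u: "u \<in> carrier_vec m"
  let ?w = "A *\<^sub>v u"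
  have "vec_l2norm ?w * vec_l2norm ?w = cmod (?w \<bullet>c ?w)"
    unfolding cscalar_prod_self norm_of_real by (simp add: power2_eq_square)
  also have "\<dots> \<le> vec_l2norm ?w * (K * vec_l2norm u)"
    using le[OF u mult_mat_vec_carrier[OF A u]] by (simp add: mult_ac)
  finally show "vec_l2norm ?w \<le> K * vec_l2norm u"
    using K vec_l2norm_nonneg[of ?w]
    by (cases "vec_l2norm ?w = 0") (auto simp: mult_le_cancel_left)
qed

lemma cscalar_prod_mat_opnorm:
  assumes A: "A \<in> carrier_mat n m" and u: "u \<in> carrier_vec m" and w: "w \<in> carrier_vec n"
  shows "cmod ((A *\<^sub>v u) \<bullet>c w) \<le> mat_opnorm A * (vec_l2norm u * vec_l2norm w)"
proof -
  have "cmod ((A *\<^sub>v u) \<bullet>c w) \<le> vec_l2norm (A *\<^sub>v u) * vec_l2norm w"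
    using A u w by (intro cscalar_prod_cauchy_schwarz) auto
  also have "\<dots> \<le> mat_opnorm A * vec_l2norm u * vec_l2norm w"
    by (intro mult_right_mono mat_opnorm_bound[OF A u]) simp
  finally show ?thesis by (simp add: mult.assoc)
qed

definition bdiag :: "nat \<Rightarrow> complex mat \<Rightarrow> complex mat \<Rightarrow> complex mat" where
  "bdiag r C D = diag_block_mat (replicate r C @ [D])"

lemma bdiag_0 [simp]: "bdiag 0 C D = D"
  by (simp add: bdiag_def del: diag_block_mat.simps)

lemma bdiag_dim [simp]:
  "dim_row (bdiag r C D) = r * dim_row C + dim_row D"
  "dim_col (bdiag r C D) = r * dim_col C + dim_col D"
  by (simp_all add: bdiag_def dim_diag_block_mat sum_list_replicate)

lemma bdiag_carrier [simp]:
  assumes "C \<in> carrier_mat m m" "D \<in> carrier_mat k k"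
  shows "bdiag r C D \<in> carrier_mat (r * m + k) (r * m + k)"
  using assms by (intro carrier_matI) simp_all

lemma bdiag_Suc:
  assumes "C \<in> carrier_mat m m" "D \<in> carrier_mat k k"
  shows "bdiag (Suc r) C D = four_block_mat C (0\<^sub>m m (r * m + k)) (0\<^sub>m (r * m + k) m) (bdiag r C D)"
  using assms bdiag_carrier[OF assms, of r] by (simp add: bdiag_def Let_def)

lemma bdiag_index:
  assumes C: "C \<in> carrier_mat m m" and D: "D \<in> carrier_mat k k"
    and "i < r * m + k" "j < r * m + k"
  shows "bdiag r C D $$ (i, j) =
    (if i < r * m then if j < r * m \<and> i div m = j div m then C $$ (i mod m, j mod m) else 0
     else if j < r * m then 0 else D $$ (i - r * m, j - r * m))"
  using assms(3,4)
proof (induction r arbitrary: i j)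
  case 0
  then show ?case by simp
next
  case (Suc r)
  note c = bdiag_carrier[OF C D, of r]
  have div: "i div m = Suc ((i - m) div m)" if "0 < m" "m \<le> i" for i
    using that by (simp add: le_div_geq)
  have mod: "i mod m = (i - m) mod m" if "m \<le> i" for i
    using that by (simp add: le_mod_geq)
  have idx: "bdiag (Suc r) C D $$ (i, j) =
     (if i < m then if j < m then C $$ (i, j) else 0
      else if j < m then 0 else bdiag r C D $$ (i - m, j - m))"
    using Suc.prems C D by (auto simp: bdiag_Suc[OF C D])
  show ?case
  proof (cases "i < m \<or> j < m")
    case True
    then show ?thesis
      using Suc.prems div[of i] div[of j] unfolding idx by (auto simp: not_less)
  next
    case False
    then have ge: "m \<le> i" "m \<le> j" by auto
    have IH: "bdiag r C D $$ (i - m, j - m) =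
      (if i - m < r * m then if j - m < r * m \<and> (i - m) div m = (j - m) div m then C $$ ((i - m) mod m, (j - m) mod m) else 0
       else if j - m < r * m then 0 else D $$ (i - m - r * m, j - m - r * m))"
      using Suc.prems ge by (intro Suc.IH) auto
    show ?thesis
    \<comment> \<open>For m = 0 division degenerates (\<open>i div 0 = 0\<close>), so removing a
      block does not lower the block number; only D is left then.\<close>
    proof (cases "m = 0")
      case True
      then show ?thesis using idx IH by simp
    next
      case False
      then have "i div m = Suc ((i - m) div m)" "j div m = Suc ((j - m) div m)"
        "i mod m = (i - m) mod m" "j mod m = (j - m) mod m"
        "i < Suc r * m \<longleftrightarrow> i - m < r * m" "j < Suc r * m \<longleftrightarrow> j - m < r * m"
        "i - Suc r * m = i - m - r * m" "j - Suc r * m = j - m - r * m"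
        using ge div mod by auto
      then show ?thesis using ge IH unfolding idx by simp
    qed
  qed
qed

lemma bdiag_index_block:
  assumes C: "C \<in> carrier_mat m m" and D: "D \<in> carrier_mat k k"
    and "\<beta> < r" "a < m" "b < m"
  shows "bdiag r C D $$ (\<beta> * m + a, \<beta> * m + b) = C $$ (a, b)"
proof -
  have "Suc \<beta> * m \<le> r * m" using assms(3) by (intro mult_le_mono1) simp
  then have "\<beta> * m + a < r * m" "\<beta> * m + b < r * m" using assms(4,5) by simp_all
  then show ?thesis using assms by (simp add: bdiag_index[OF C D])
qed

lemma bdiag_index_last:
  assumes C: "C \<in> carrier_mat m m" and D: "D \<in> carrier_mat k k" and "a < k" "b < k"
  shows "bdiag r C D $$ (r * m + a, r * m + b) = D $$ (a, b)"
  using assms by (simp add: bdiag_index[OF C D])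

lemma mod_less_of_less_mult: "i mod m < m" if "i < r * m" for i m r :: nat
  using that by (cases "m = 0") auto

lemma bdiag_add:
  assumes C: "C \<in> carrier_mat m m" "C' \<in> carrier_mat m m"
    and D: "D \<in> carrier_mat k k" "D' \<in> carrier_mat k k"
  shows "bdiag r C D + bdiag r C' D' = bdiag r (C + C') (D + D')"
proof (rule eq_matI)
  fix i j assume "i < dim_row (bdiag r (C + C') (D + D'))" "j < dim_col (bdiag r (C + C') (D + D'))"
  then have ij: "i < r * m + k" "j < r * m + k" using C D by auto
  then show "(bdiag r C D + bdiag r C' D') $$ (i, j) = bdiag r (C + C') (D + D') $$ (i, j)"
    using C D mod_less_of_less_mult[of i r m] mod_less_of_less_mult[of j r m]
    by (auto simp: bdiag_index[of _ m _ k])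
qed (use C D in auto)

lemma bdiag_smult:
  assumes C: "C \<in> carrier_mat m m" and D: "D \<in> carrier_mat k k"
  shows "c \<cdot>\<^sub>m bdiag r C D = bdiag r (c \<cdot>\<^sub>m C) (c \<cdot>\<^sub>m D)"
proof (rule eq_matI)
  fix i j assume "i < dim_row (bdiag r (c \<cdot>\<^sub>m C) (c \<cdot>\<^sub>m D))" "j < dim_col (bdiag r (c \<cdot>\<^sub>m C) (c \<cdot>\<^sub>m D))"
  then have ij: "i < r * m + k" "j < r * m + k" using C D by auto
  then show "(c \<cdot>\<^sub>m bdiag r C D) $$ (i, j) = bdiag r (c \<cdot>\<^sub>m C) (c \<cdot>\<^sub>m D) $$ (i, j)"
    using C D mod_less_of_less_mult[of i r m] mod_less_of_less_mult[of j r m]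
    by (auto simp: bdiag_index[of _ m _ k])
qed (use C D in auto)

lemma bdiag_one: "bdiag r (1\<^sub>m m) (1\<^sub>m k) = 1\<^sub>m (r * m + k)"
proof (induction r)
  case (Suc r)
  show ?case
    unfolding bdiag_Suc[OF one_carrier_mat one_carrier_mat] Suc.IH
    by (rule eq_matI) auto
qed simp

lemma bdiag_one_minus:
  assumes C: "C \<in> carrier_mat m m" and D: "D \<in> carrier_mat k k"
  shows "1\<^sub>m (r * m + k) - bdiag r C D = bdiag r (1\<^sub>m m - C) (1\<^sub>m k - D)"
proof -
  have m: "1\<^sub>m j - X = 1\<^sub>m j + (- 1) \<cdot>\<^sub>m X" if "X \<in> carrier_mat j j" for j and X :: "complex mat"
    using that by (intro eq_matI) auto
  have "1\<^sub>m (r * m + k) - bdiag r C D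
      = bdiag r (1\<^sub>m m) (1\<^sub>m k) + bdiag r ((- 1) \<cdot>\<^sub>m C) ((- 1) \<cdot>\<^sub>m D)"
    by (simp only: m[OF bdiag_carrier[OF C D]] bdiag_smult[OF C D] bdiag_one)
  also have "\<dots> = bdiag r (1\<^sub>m m - C) (1\<^sub>m k - D)"
    unfolding m[OF C] m[OF D] using C D by (intro bdiag_add) auto
  finally show ?thesis .
qed

lemma bdiag_adjoint:
  assumes C: "C \<in> carrier_mat m m" and D: "D \<in> carrier_mat k k"
  shows "mat_adjoint (bdiag r C D) = bdiag r (mat_adjoint C) (mat_adjoint D)"
proof (rule eq_matI)
  fix i j assume "i < dim_row (bdiag r (mat_adjoint C) (mat_adjoint D))"
    "j < dim_col (bdiag r (mat_adjoint C) (mat_adjoint D))"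
  then have ij: "i < r * m + k" "j < r * m + k" using C D by auto
  then show "mat_adjoint (bdiag r C D) $$ (i, j) = bdiag r (mat_adjoint C) (mat_adjoint D) $$ (i, j)"
    using mod_less_of_less_mult[of i r m] mod_less_of_less_mult[of j r m]
    by (auto simp: mat_adjoint_index[OF bdiag_carrier[OF C D]] bdiag_index[OF C D] mat_adjoint_index[OF C]
        mat_adjoint_index[OF D] bdiag_index[OF mat_adjoint_carrier[OF C] mat_adjoint_carrier[OF D]])
qed (use C D in auto)

lemma bdiag_mult:
  assumes C: "C \<in> carrier_mat m m" "C' \<in> carrier_mat m m"
    and D: "D \<in> carrier_mat k k" "D' \<in> carrier_mat k k"
  shows "bdiag r C D * bdiag r C' D' = bdiag r (C * C') (D * D')"
proof (induction r)
  case (Suc r)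
  note c = bdiag_carrier[OF C(1) D(1), of r] bdiag_carrier[OF C(2) D(2), of r]
  let ?n = "r * m + k"
  have CC: "C * C' \<in> carrier_mat m m" "D * D' \<in> carrier_mat k k" using C D by auto
  have "four_block_mat C (0\<^sub>m m ?n) (0\<^sub>m ?n m) (bdiag r C D)
      * four_block_mat C' (0\<^sub>m m ?n) (0\<^sub>m ?n m) (bdiag r C' D')
    = four_block_mat (C * C' + 0\<^sub>m m ?n * 0\<^sub>m ?n m) (C * 0\<^sub>m m ?n + 0\<^sub>m m ?n * bdiag r C' D')
        (0\<^sub>m ?n m * C' + bdiag r C D * 0\<^sub>m ?n m) (0\<^sub>m ?n m * 0\<^sub>m m ?n + bdiag r C D * bdiag r C' D')"
    by (rule mult_four_block_mat[OF C(1) zero_carrier_mat zero_carrier_mat c(1)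
        C(2) zero_carrier_mat zero_carrier_mat c(2)])
  also have "\<dots> = four_block_mat (C * C') (0\<^sub>m m ?n) (0\<^sub>m ?n m) (bdiag r C D * bdiag r C' D')"
    using C CC c mult_carrier_mat[OF c]
      left_mult_zero_mat[OF c(2), of m] right_mult_zero_mat[OF c(1), of m] by simp
  finally show ?case
    unfolding bdiag_Suc[OF C(1) D(1)] bdiag_Suc[OF C(2) D(2)] bdiag_Suc[OF CC] Suc.IH .
qed simp

lemma bdiag_tr:
  assumes C: "C \<in> carrier_mat m m" and D: "D \<in> carrier_mat k k"
  shows "mat_tr (bdiag r C D) = of_nat r * mat_tr C + mat_tr D"
proof -
  have "mat_tr (bdiag r C D) = (\<Sum>i<r * m + k. bdiag r C D $$ (i, i))"
    using C D by (simp add: mat_tr_def)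
  also have "\<dots> = (\<Sum>\<beta><r. \<Sum>a<m. C $$ (a, a)) + (\<Sum>a<k. D $$ (a, a))"
    unfolding sum_lessThan_add sum_lessThan_blocks
    by (intro arg_cong2[of _ _ _ _ "(+)"] sum.cong refl)
      (auto simp: bdiag_index_block[OF C D] bdiag_index_last[OF C D])
  finally show ?thesis using C D by (simp add: mat_tr_def)
qed

lemma vec_l2norm_append:
  "(vec_l2norm (x @\<^sub>v y))\<^sup>2 = (vec_l2norm x)\<^sup>2 + (vec_l2norm y)\<^sup>2"
  by (simp add: vec_l2norm_power2 sum_lessThan_add)

lemma mat_opnorm_four_block_diag:
  assumes C: "C \<in> carrier_mat m m" and D: "D \<in> carrier_mat k k"
  shows "mat_opnorm (four_block_mat C (0\<^sub>m m k) (0\<^sub>m k m) D) \<le> max (mat_opnorm C) (mat_opnorm D)"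
proof (rule mat_opnorm_leI)
  let ?K = "max (mat_opnorm C) (mat_opnorm D)"
  show "four_block_mat C (0\<^sub>m m k) (0\<^sub>m k m) D \<in> carrier_mat (m + k) (m + k)"
    using C D by simp
  show K: "0 \<le> ?K" by (simp add: mat_opnorm_nonneg le_max_iff_disj)
  fix v :: "complex vec" assume v: "v \<in> carrier_vec (m + k)"
  define x y where "x = vec_first v m" and "y = vec_last v k"
  have x: "x \<in> carrier_vec m" and y: "y \<in> carrier_vec k" and vxy: "v = x @\<^sub>v y"
    using v by (auto simp: x_def y_def)
  have "four_block_mat C (0\<^sub>m m k) (0\<^sub>m k m) D *\<^sub>v v = (C *\<^sub>v x) @\<^sub>v (D *\<^sub>v y)"
    unfolding vxy by (subst four_block_mat_mult_vec[OF C _ _ D x y]) (use C D x y in auto)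
  then have "(vec_l2norm (four_block_mat C (0\<^sub>m m k) (0\<^sub>m k m) D *\<^sub>v v))\<^sup>2
      = (vec_l2norm (C *\<^sub>v x))\<^sup>2 + (vec_l2norm (D *\<^sub>v y))\<^sup>2"
    by (simp add: vec_l2norm_append)
  also have "\<dots> \<le> (?K * vec_l2norm x)\<^sup>2 + (?K * vec_l2norm y)\<^sup>2"
  proof (intro add_mono power_mono)
    show "vec_l2norm (C *\<^sub>v x) \<le> ?K * vec_l2norm x"
      using mat_opnorm_bound[OF C x] by (rule order.trans) (simp add: mult_right_mono)
    show "vec_l2norm (D *\<^sub>v y) \<le> ?K * vec_l2norm y"
      using mat_opnorm_bound[OF D y] by (rule order.trans) (simp add: mult_right_mono)
  qed auto
  also have "\<dots> = (?K * vec_l2norm v)\<^sup>2"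
    by (simp add: vxy power_mult_distrib vec_l2norm_append distrib_left)
  finally show "vec_l2norm (four_block_mat C (0\<^sub>m m k) (0\<^sub>m k m) D *\<^sub>v v) \<le> ?K * vec_l2norm v"
    by (rule power2_le_imp_le) (simp add: K)
qed

lemma mat_opnorm_bdiag:
  assumes C: "C \<in> carrier_mat m m" and D: "D \<in> carrier_mat k k"
  shows "mat_opnorm (bdiag r C D) \<le> max (mat_opnorm C) (mat_opnorm D)"
proof (induction r)
  case (Suc r)
  have "mat_opnorm (bdiag (Suc r) C D) \<le> max (mat_opnorm C) (mat_opnorm (bdiag r C D))"
    unfolding bdiag_Suc[OF C D] by (rule mat_opnorm_four_block_diag[OF C bdiag_carrier[OF C D]])
  then show ?case using Suc.IH by linarith
qed simp

text \<open>Vectors supported in the last block see only D. This is the lower bound for D in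
  \<open>opnorm_demb\<close>, where the second summand supplies the one for C.\<close>

lemma mat_opnorm_bdiag_last:
  assumes C: "C \<in> carrier_mat m m" and D: "D \<in> carrier_mat k k"
  shows "mat_opnorm D \<le> mat_opnorm (bdiag r C D)"
proof (rule mat_opnorm_leI_cscalar_prod[OF D mat_opnorm_nonneg])
  fix u w :: "complex vec" assume u: "u \<in> carrier_vec k" and w: "w \<in> carrier_vec k"
  let ?n = "r * m + k"
  let ?i = "inj_vec ?n (r * m)"
  note c = bdiag_carrier[OF C D, of r]
  have "(D *\<^sub>v u) \<bullet>c w = (bdiag r C D *\<^sub>v ?i u) \<bullet>c ?i w"
    unfolding cscalar_prod_inj_vec[OF c u w order.refl] cscalar_prod_mult_mat_vec[OF D u w]
    by (intro sum.cong refl) (simp add: bdiag_index_last[OF C D])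
  also have "cmod \<dots> \<le> mat_opnorm (bdiag r C D) * (vec_l2norm (?i u) * vec_l2norm (?i w))"
    by (rule cscalar_prod_mat_opnorm[OF c]) auto
  finally show "cmod ((D *\<^sub>v u) \<bullet>c w) \<le> mat_opnorm (bdiag r C D) * (vec_l2norm u * vec_l2norm w)"
    using u w by (simp add: inj_vec_l2norm)
qed

text \<open>The origin of r + 1: v is a sum of r + 1 block components, each no longer than v, and
  the triangle inequality adds their images. Cauchy-Schwarz over the blocks would even give the
  square root of r + 1.\<close>

lemma mat_opnorm_le_blocks:
  assumes A: "A \<in> carrier_mat n (r * m + k)" and L: "0 \<le> L"
    and blk: "\<And>\<beta> u. \<beta> < r \<Longrightarrow> u \<in> carrier_vec m \<Longrightarrow>
      vec_l2norm (A *\<^sub>v inj_vec (r * m + k) (\<beta> * m) u) \<le> L * vec_l2norm u"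
    and last: "\<And>u. u \<in> carrier_vec k \<Longrightarrow>
      vec_l2norm (A *\<^sub>v inj_vec (r * m + k) (r * m) u) \<le> L * vec_l2norm u"
  shows "mat_opnorm A \<le> (real r + 1) * L"
proof (rule mat_opnorm_leI[OF A])
  let ?n = "r * m + k"
  show "0 \<le> (real r + 1) * L" using L by simp
  fix v :: "complex vec" assume v: "v \<in> carrier_vec ?n"
  define part where "part p l = vec l (\<lambda>a. v $ (p + a))" for p l
  \<comment> \<open>\<open>pre \<beta>\<close> keeps the first \<beta> blocks of v, so each
    induction step adds one block and costs L times the norm of v.\<close>
  define pre where "pre \<beta> = vec ?n (\<lambda>j. if j < \<beta> * m then v $ j else 0)" for \<beta>
  have pre_c: "pre \<beta> \<in> carrier_vec ?n" for \<beta> by (simp add: pre_def)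
  have part_c: "part p l \<in> carrier_vec l" for p l by (simp add: part_def)
  have part_norm: "vec_l2norm (part p l) \<le> vec_l2norm v" if "p + l \<le> ?n" for p l
  proof (rule power2_le_imp_le)
    have "(vec_l2norm v)\<^sup>2 = (\<Sum>i<p + l + (?n - (p + l)). (cmod (v $ i))\<^sup>2)"
      using v that by (simp add: vec_l2norm_power2)
    also have "\<dots> \<ge> (\<Sum>i<l. (cmod (v $ (p + i)))\<^sup>2)"
      unfolding sum_lessThan_add by (simp add: sum_nonneg add_increasing add_increasing2)
    finally show "(vec_l2norm (part p l))\<^sup>2 \<le> (vec_l2norm v)\<^sup>2"
      by (simp add: vec_l2norm_power2 part_def)
  qed simp
  have pre_le: "vec_l2norm (A *\<^sub>v pre \<beta>) \<le> real \<beta> * (L * vec_l2norm v)" if "\<beta> \<le> r" for \<beta>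
    using that
  proof (induction \<beta>)
    case 0
    have "pre 0 = 0\<^sub>v ?n" by (auto simp: pre_def)
    moreover have "A *\<^sub>v 0\<^sub>v ?n = 0\<^sub>v n" using A by auto
    ultimately show ?case by simp
  next
    case (Suc \<beta>)
    let ?x = "inj_vec ?n (\<beta> * m) (part (\<beta> * m) m)"
    have "Suc \<beta> * m \<le> r * m" using Suc.prems by (intro mult_le_mono1) simp
    then have le: "\<beta> * m + m \<le> ?n" by simp
    have "pre (Suc \<beta>) = pre \<beta> + ?x"
      using le by (intro eq_vecI) (auto simp: pre_def inj_vec_def part_def)
    then have "A *\<^sub>v pre (Suc \<beta>) = A *\<^sub>v pre \<beta> + A *\<^sub>v ?x"
      using mult_add_distrib_mat_vec[OF A pre_c inj_vec_carrier] by simp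
    then have "vec_l2norm (A *\<^sub>v pre (Suc \<beta>)) \<le> vec_l2norm (A *\<^sub>v pre \<beta>) + vec_l2norm (A *\<^sub>v ?x)"
      using vec_l2norm_triangle[OF mult_mat_vec_carrier[OF A pre_c] mult_mat_vec_carrier[OF A inj_vec_carrier]]
      by simp
    also have "\<dots> \<le> real \<beta> * (L * vec_l2norm v) + L * vec_l2norm v"
      using Suc.IH Suc.prems blk[OF _ part_c, of \<beta>] mult_left_mono[OF part_norm[OF le] L]
      by (intro add_mono) (auto intro: order.trans)
    finally show ?case by (simp add: algebra_simps)
  qed
  let ?y = "inj_vec ?n (r * m) (part (r * m) k)"
  have "v = pre r + ?y"
    using v by (intro eq_vecI) (auto simp: pre_def inj_vec_def part_def)
  then have "A *\<^sub>v v = A *\<^sub>v pre r + A *\<^sub>v ?y"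
    using mult_add_distrib_mat_vec[OF A pre_c inj_vec_carrier] by simp
  then have "vec_l2norm (A *\<^sub>v v) \<le> vec_l2norm (A *\<^sub>v pre r) + vec_l2norm (A *\<^sub>v ?y)"
    using vec_l2norm_triangle[OF mult_mat_vec_carrier[OF A pre_c] mult_mat_vec_carrier[OF A inj_vec_carrier]]
    by simp
  also have "\<dots> \<le> real r * (L * vec_l2norm v) + L * vec_l2norm v"
    using pre_le[OF order.refl] last[OF part_c] mult_left_mono[OF part_norm[OF order.refl] L]
    by (intro add_mono) (auto intro: order.trans)
  finally show "vec_l2norm (A *\<^sub>v v) \<le> (real r + 1) * L * vec_l2norm v"
    by (simp add: algebra_simps)
qed

section \<open>Trace-preserving conditional expectations\<close>

definition dsum_alg :: "nat \<Rightarrow> nat \<Rightarrow> dsum set" where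
  "dsum_alg n m = carrier_mat n n \<times> carrier_mat m m"

definition ds_proj :: "nat \<Rightarrow> nat \<Rightarrow> dsum \<Rightarrow> bool" where
  "ds_proj n m e \<longleftrightarrow> proj_mat n (fst e) \<and> proj_mat m (snd e)"

definition ds_compl :: "nat \<Rightarrow> nat \<Rightarrow> dsum \<Rightarrow> dsum" where
  "ds_compl n m e = (1\<^sub>m n - fst e, 1\<^sub>m m - snd e)"

text \<open>The weights multiply unnormalised traces, so the division by matrix sizes in
  \<open>AF_tau\<close> is absorbed into w1 and w2.\<close>

definition wtr :: "real \<Rightarrow> real \<Rightarrow> dsum \<Rightarrow> complex" where
  "wtr w1 w2 a = of_real w1 * mat_tr (fst a) + of_real w2 * mat_tr (snd a)"

lemma mat_tr_add:
  assumes "A \<in> carrier_mat n n" "B \<in> carrier_mat n n"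
  shows "mat_tr (A + B) = mat_tr A + mat_tr B"
  using assms by (simp add: mat_tr_def sum.distrib)

lemma mat_tr_smult:
  assumes "A \<in> carrier_mat n n"
  shows "mat_tr (c \<cdot>\<^sub>m A) = c * mat_tr A"
  using assms by (simp add: mat_tr_def sum_distrib_left)

lemma dsum_alg_closed:
  "a \<in> dsum_alg n m \<Longrightarrow> b \<in> dsum_alg n m \<Longrightarrow> ds_add a b \<in> dsum_alg n m"
  "a \<in> dsum_alg n m \<Longrightarrow> b \<in> dsum_alg n m \<Longrightarrow> ds_mult a b \<in> dsum_alg n m"
  "a \<in> dsum_alg n m \<Longrightarrow> ds_scale c a \<in> dsum_alg n m"
  "a \<in> dsum_alg n m \<Longrightarrow> ds_star a \<in> dsum_alg n m"
  "a \<in> dsum_alg n m \<Longrightarrow> ds_compl n m a \<in> dsum_alg n m"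
  by (auto simp: dsum_alg_def ds_add_def ds_mult_def ds_scale_def ds_star_def ds_compl_def
      intro!: minus_carrier_mat mult_carrier_mat)

lemma wtr_add:
  assumes "a \<in> dsum_alg n m" "b \<in> dsum_alg n m"
  shows "wtr w1 w2 (ds_add a b) = wtr w1 w2 a + wtr w1 w2 b"
  using assms
  by (auto simp: dsum_alg_def ds_add_def wtr_def mat_tr_add[of _ n] mat_tr_add[of _ m] distrib_left)

lemma wtr_scale:
  assumes "a \<in> dsum_alg n m"
  shows "wtr w1 w2 (ds_scale c a) = c * wtr w1 w2 a"
  using assms
  by (auto simp: dsum_alg_def ds_scale_def wtr_def mat_tr_smult[of _ n] mat_tr_smult[of _ m] distrib_left)

lemma ds_mult_add_right:
  assumes "a \<in> dsum_alg n m" "b \<in> dsum_alg n m" "c \<in> dsum_alg n m"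
  shows "ds_mult a (ds_add b c) = ds_add (ds_mult a b) (ds_mult a c)"
  using assms
  by (auto simp: dsum_alg_def ds_add_def ds_mult_def mult_add_distrib_mat[of _ n n] mult_add_distrib_mat[of _ m m])

lemma ds_mult_scale_right:
  assumes "a \<in> dsum_alg n m" "b \<in> dsum_alg n m"
  shows "ds_mult a (ds_scale c b) = ds_scale c (ds_mult a b)"
  using assms
  by (auto simp: dsum_alg_def ds_scale_def ds_mult_def mult_smult_distrib[of _ n n] mult_smult_distrib[of _ m m])

lemma mat_mult_compl:
  assumes "A \<in> carrier_mat n n" "E \<in> carrier_mat n n"
  shows "A * E + A * (1\<^sub>m n - E) = (A :: complex mat)" "(E + (1\<^sub>m n - E)) = 1\<^sub>m n"
    "E * A + (1\<^sub>m n - E) * A = A"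
proof -
  have c: "1\<^sub>m n - E \<in> carrier_mat n n" using assms(2) by (rule minus_carrier_mat)
  show e: "E + (1\<^sub>m n - E) = 1\<^sub>m n" using assms(2) by (intro eq_matI) auto
  show "A * E + A * (1\<^sub>m n - E) = A"
    using assms c e by (simp add: mult_add_distrib_mat[symmetric, of A n n E n])
  show "E * A + (1\<^sub>m n - E) * A = A"
    using assms c e by (simp add: add_mult_distrib_mat[symmetric, of E n n _ A n])
qed

lemma ds_mult_compl:
  assumes "a \<in> dsum_alg n m" "e \<in> dsum_alg n m"
  shows "ds_add (ds_mult a e) (ds_mult a (ds_compl n m e)) = a"
    "ds_add (ds_mult e a) (ds_mult (ds_compl n m e) a) = a"
  using assms by (auto simp: dsum_alg_def ds_add_def ds_mult_def ds_compl_def mat_mult_compl)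

lemma ds_compl_compl:
  assumes "e \<in> dsum_alg n m"
  shows "ds_compl n m (ds_compl n m e) = e"
proof -
  have "1\<^sub>m j - (1\<^sub>m j - E) = E" if "E \<in> carrier_mat j j" for j and E :: "complex mat"
    using that by (intro eq_matI) auto
  then show ?thesis using assms by (auto simp: dsum_alg_def ds_compl_def)
qed

lemma proj_mat_compl:
  assumes "proj_mat n E"
  shows "proj_mat n (1\<^sub>m n - E)"
proof -
  have c: "E \<in> carrier_mat n n" and adj: "mat_adjoint E = E" and idem: "E * E = E"
    using assms by (auto simp: proj_mat_def)
  have c': "1\<^sub>m n - E \<in> carrier_mat n n" using c by (rule minus_carrier_mat)
  have "mat_adjoint (1\<^sub>m n - E) = 1\<^sub>m n - E"
  proof (rule eq_matI)
    fix i j assume ij: "i < dim_row (1\<^sub>m n - E)" "j < dim_col (1\<^sub>m n - E)"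
    then have "cnj (E $$ (j, i)) = E $$ (i, j)"
      using mat_adjoint_index[OF c, of i j] c by (simp add: adj)
    then show "mat_adjoint (1\<^sub>m n - E) $$ (i, j) = (1\<^sub>m n - E) $$ (i, j)"
      using ij c by (subst mat_adjoint_index[OF c']) auto
  qed (use c in auto)
  moreover have "(1\<^sub>m n - E) * (1\<^sub>m n - E) = 1\<^sub>m n - E"
  proof -
    have "(1\<^sub>m n - E) * (1\<^sub>m n - E) = (1\<^sub>m n - E) - (1\<^sub>m n - E) * E"
      using c c' by (subst mult_minus_distrib_mat[of _ n n]) auto
    also have "(1\<^sub>m n - E) * E = 0\<^sub>m n n"
      using c by (subst minus_mult_distrib_mat[of _ n n]) (auto simp: idem)
    also have "1\<^sub>m n - E - 0\<^sub>m n n = 1\<^sub>m n - E"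
      using c by (intro eq_matI) auto
    finally show ?thesis .
  qed
  ultimately show ?thesis using c' by (simp add: proj_mat_def)
qed

lemma ds_proj_compl: "ds_proj n m e \<Longrightarrow> ds_proj n m (ds_compl n m e)"
  by (simp add: ds_proj_def ds_compl_def proj_mat_compl)

lemma opnorm_nonneg: "0 \<le> opnorm a"
  by (simp add: opnorm_def mat_opnorm_nonneg le_max_iff_disj)

lemma wtr_proj_mult:
  assumes e: "ds_proj n m e" and b: "b \<in> dsum_alg n m" and w: "0 \<le> w1" "0 \<le> w2"
  shows "cmod (wtr w1 w2 (ds_mult e b)) \<le> Re (wtr w1 w2 e) * opnorm b"
    and "wtr w1 w2 e = complex_of_real (Re (wtr w1 w2 e))" "0 \<le> Re (wtr w1 w2 e)"
proof -
  have c: "proj_mat n (fst e)" "proj_mat m (snd e)" "fst b \<in> carrier_mat n n" "snd b \<in> carrier_mat m m"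
    using e b by (auto simp: ds_proj_def dsum_alg_def)
  note p = mat_tr_proj_mult[OF c(1,3)] and q = mat_tr_proj_mult[OF c(2,4)]
  show "wtr w1 w2 e = complex_of_real (Re (wtr w1 w2 e))"
    unfolding wtr_def by (subst p(2), subst q(2)) simp
  show "0 \<le> Re (wtr w1 w2 e)"
    unfolding wtr_def using p(3) q(3) w by simp
  have "cmod (wtr w1 w2 (ds_mult e b)) \<le> w1 * cmod (mat_tr (fst e * fst b)) + w2 * cmod (mat_tr (snd e * snd b))"
    unfolding wtr_def ds_mult_def using w by (intro norm_triangle_le) (simp add: norm_mult)
  also have "\<dots> \<le> w1 * (Re (mat_tr (fst e)) * opnorm b) + w2 * (Re (mat_tr (snd e)) * opnorm b)"
    using order.trans[OF p(1) mult_left_mono[OF _ p(3), of _ "opnorm b"]]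
      order.trans[OF q(1) mult_left_mono[OF _ q(3), of _ "opnorm b"]] w
    by (intro add_mono mult_left_mono) (auto simp: opnorm_def)
  also have "\<dots> = Re (wtr w1 w2 e) * opnorm b"
    by (simp add: wtr_def algebra_simps)
  finally show "cmod (wtr w1 w2 (ds_mult e b)) \<le> Re (wtr w1 w2 e) * opnorm b" .
qed

lemma ds_proj_perturb_opnorm:
  assumes e: "ds_proj n m e" and a: "a \<in> dsum_alg n m"
  shows "opnorm (ds_add e (ds_scale c (ds_mult a (ds_compl n m e)))) \<le> sqrt (1 + (cmod c)\<^sup>2 * (opnorm a)\<^sup>2)"
proof -
  have c: "proj_mat n (fst e)" "proj_mat m (snd e)" "fst a \<in> carrier_mat n n" "snd a \<in> carrier_mat m m"
    using e a by (auto simp: ds_proj_def dsum_alg_def)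
  have le: "sqrt (1 + (cmod c)\<^sup>2 * (mat_opnorm (fst a))\<^sup>2) \<le> sqrt (1 + (cmod c)\<^sup>2 * (opnorm a)\<^sup>2)"
    "sqrt (1 + (cmod c)\<^sup>2 * (mat_opnorm (snd a))\<^sup>2) \<le> sqrt (1 + (cmod c)\<^sup>2 * (opnorm a)\<^sup>2)"
    by (auto simp: opnorm_def mat_opnorm_nonneg intro!: mult_left_mono power_mono)
  show ?thesis
    using order.trans[OF proj_mat_perturb_opnorm[OF c(1,3), of c] le(1)]
      order.trans[OF proj_mat_perturb_opnorm[OF c(2,4), of c] le(2)]
    by (simp add: opnorm_def[of "(_, _)"] ds_add_def ds_scale_def ds_mult_def ds_compl_def)
qed

text \<open>With c a small positive multiple of the conjugate of z, the left side is x + s |z|^2, a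
  linear gain, while the right side is at most x + x K s^2 |z|^2.\<close>

lemma complex_growth_imp_zero:
  fixes z :: complex and x K :: real
  assumes x: "0 \<le> x" and K: "0 \<le> K"
    and le: "\<And>c. cmod (complex_of_real x + c * z) \<le> x * sqrt (1 + (cmod c)\<^sup>2 * K)"
  shows "z = 0"
proof (rule ccontr)
  assume z: "z \<noteq> 0"
  \<comment> \<open>Chosen so that x K s < 1, which keeps the quadratic term x K s^2 y below the
    linear gain s y; the added 1 covers x K = 0.\<close>
  define s where "s = 1 / (x * K + 1)"
  have xK: "0 \<le> x * K" using x K by simp
  have s: "0 < s" "x * K * s < 1" using xK by (auto simp: s_def divide_less_eq)
  define y where "y = (cmod z)\<^sup>2"
  have y: "0 < y" using z by (simp add: y_def)
  have "complex_of_real x + of_real s * cnj z * z = complex_of_real (x + s * y)"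
    by (simp add: y_def complex_norm_square mult_ac del: of_real_power)
  then have "x + s * y = cmod (complex_of_real x + of_real s * cnj z * z)"
    using x s y by (simp del: of_real_add of_real_mult)
  also have "\<dots> \<le> x * sqrt (1 + (cmod (of_real s * cnj z))\<^sup>2 * K)" by (rule le)
  also have "(cmod (of_real s * cnj z))\<^sup>2 = s\<^sup>2 * y"
    by (simp add: norm_mult power_mult_distrib y_def)
  also have "x * sqrt (1 + s\<^sup>2 * y * K) \<le> x * (1 + s\<^sup>2 * y * K)"
  proof (intro mult_left_mono[OF _ x] real_le_lsqrt)
    have t: "0 \<le> s\<^sup>2 * y * K" using K y by simp
    then show "0 \<le> 1 + s\<^sup>2 * y * K" by simp
    from t show "1 + s\<^sup>2 * y * K \<le> (1 + s\<^sup>2 * y * K)\<^sup>2"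
      by (intro self_le_power) auto
  qed
  finally have "s * y \<le> x * K * s * (s * y)"
    by (simp add: algebra_simps power2_eq_square)
  then show False
    using s y by (simp add: mult_less_cancel_right1 not_le)
qed

text \<open>The functional \<open>a \<mapsto> \<tau>(e P(a))\<close> has norm \<open>\<tau>(e)\<close> and attains it at the projection \<open>e\<close>, while
  \<open>\<parallel>e + c a (1 - e)\<parallel>\<close> grows only quadratically in \<open>c\<close>; hence it vanishes on \<open>a (1 - e)\<close>.\<close>

lemma cond_exp_proj_annihilates:
  assumes P: "is_cond_exp (dsum_alg n m) B P" and B: "B \<subseteq> dsum_alg n m"
    and e: "ds_proj n m e" "e \<in> B" and a: "a \<in> dsum_alg n m" and w: "0 \<le> w1" "0 \<le> w2"
  shows "wtr w1 w2 (ds_mult e (P (ds_mult a (ds_compl n m e)))) = 0"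
proof (rule complex_growth_imp_zero)
  let ?A = "dsum_alg n m"
  let ?y = "ds_mult a (ds_compl n m e)"
  have eA: "e \<in> ?A" using e(2) B by auto
  have yA: "?y \<in> ?A" by (intro dsum_alg_closed a eA)
  have PA: "P x \<in> ?A" if "x \<in> ?A" for x
    using that P B by (auto simp: is_cond_exp_def)
  have idem: "ds_mult e e = e" using e(1) by (simp add: ds_proj_def proj_mat_def ds_mult_def)
  note pm = wtr_proj_mult[OF e(1) _ w]
  show "0 \<le> Re (wtr w1 w2 e)" by (rule pm(3)[OF eA])
  show "0 \<le> (opnorm a)\<^sup>2" by simp
  fix c
  let ?x = "ds_add e (ds_scale c ?y)"
  have xA: "?x \<in> ?A" by (intro dsum_alg_closed eA yA)
  have "P ?x = ds_add e (ds_scale c (P ?y))"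
    using P e eA yA dsum_alg_closed(3)[OF yA] by (simp add: is_cond_exp_def)
  then have "wtr w1 w2 (ds_mult e (P ?x)) = wtr w1 w2 e + c * wtr w1 w2 (ds_mult e (P ?y))"
    using eA PA[OF yA] idem
    by (simp add: ds_mult_add_right[of _ n m] ds_mult_scale_right[of _ n m] wtr_add[of _ n m] wtr_scale[of _ n m]
        dsum_alg_closed)
  then have "cmod (complex_of_real (Re (wtr w1 w2 e)) + c * wtr w1 w2 (ds_mult e (P ?y)))
      \<le> Re (wtr w1 w2 e) * opnorm (P ?x)"
    using pm(1)[OF PA[OF xA]] by (simp flip: pm(2)[OF eA])
  also have "\<dots> \<le> Re (wtr w1 w2 e) * opnorm ?x"
    using P xA pm(3)[OF eA] by (intro mult_left_mono) (auto simp: is_cond_exp_def)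
  also have "\<dots> \<le> Re (wtr w1 w2 e) * sqrt (1 + (cmod c)\<^sup>2 * (opnorm a)\<^sup>2)"
    using pm(3)[OF eA] by (intro mult_left_mono ds_proj_perturb_opnorm[OF e(1) a])
  finally show "cmod (complex_of_real (Re (wtr w1 w2 e)) + c * wtr w1 w2 (ds_mult e (P ?y)))
      \<le> Re (wtr w1 w2 e) * sqrt (1 + (cmod c)\<^sup>2 * (opnorm a)\<^sup>2)" .
qed

text \<open>A trace form of the module property, derived rather than assumed. In the split a = a e +
  a (1 - e) the second part is killed by \<open>cond_exp_proj_annihilates\<close>.\<close>

lemma cond_exp_tr_proj:
  assumes P: "is_cond_exp (dsum_alg n m) B P" and B: "B \<subseteq> dsum_alg n m"
    and tr: "\<And>a. a \<in> dsum_alg n m \<Longrightarrow> wtr w1 w2 (P a) = wtr w1 w2 a"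
    and e: "ds_proj n m e" "e \<in> B" "ds_compl n m e \<in> B"
    and a: "a \<in> dsum_alg n m" and w: "0 \<le> w1" "0 \<le> w2"
  shows "wtr w1 w2 (ds_mult e (P a)) = wtr w1 w2 (ds_mult a e)"
proof -
  let ?A = "dsum_alg n m"
  let ?f = "ds_compl n m e"
  have eA: "e \<in> ?A" "?f \<in> ?A" using e B by auto
  have ae: "ds_mult a e \<in> ?A" "ds_mult a ?f \<in> ?A" by (intro dsum_alg_closed a eA)+
  have PA: "P x \<in> ?A" if "x \<in> ?A" for x
    using that P B by (auto simp: is_cond_exp_def)
  have "P a = P (ds_add (ds_mult a e) (ds_mult a ?f))"
    by (simp add: ds_mult_compl[OF a eA(1)])
  also have "\<dots> = ds_add (P (ds_mult a e)) (P (ds_mult a ?f))"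
    using P ae by (simp add: is_cond_exp_def)
  finally have "wtr w1 w2 (ds_mult e (P a))
      = wtr w1 w2 (ds_mult e (P (ds_mult a e))) + wtr w1 w2 (ds_mult e (P (ds_mult a ?f)))"
    using eA PA[OF ae(1)] PA[OF ae(2)]
    by (simp add: ds_mult_add_right[of _ n m] wtr_add[of _ n m] dsum_alg_closed)
  \<comment> \<open>Both exchanged terms vanish, one by annihilation for e, the other by
    annihilation for its complement. Afterwards e and 1 - e recombine to P(a e), to which trace
    invariance applies.\<close>
  also have "\<dots> = wtr w1 w2 (ds_mult e (P (ds_mult a e))) + wtr w1 w2 (ds_mult ?f (P (ds_mult a e)))"
    using cond_exp_proj_annihilates[OF P B e(1,2) a w]
      cond_exp_proj_annihilates[OF P B ds_proj_compl[OF e(1)] e(3) a w]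
    by (simp add: ds_compl_compl[OF eA(1)])
  also have "\<dots> = wtr w1 w2 (ds_add (ds_mult e (P (ds_mult a e))) (ds_mult ?f (P (ds_mult a e))))"
    using eA PA[OF ae(1)] by (simp add: wtr_add[of _ n m] dsum_alg_closed)
  also have "\<dots> = wtr w1 w2 (ds_mult a e)"
    using ds_mult_compl(2)[OF PA[OF ae(1)] eA(1)] tr[OF ae(1)] by simp
  finally show ?thesis .
qed

lemma proj_mat_rank_one:
  assumes u: "u \<in> carrier_vec m" "vec_l2norm u = 1"
  shows "proj_mat m (mat m m (\<lambda>(i, j). u $ i * cnj (u $ j)))"
proof -
  let ?p = "mat m m (\<lambda>(i, j). u $ i * cnj (u $ j))"
  have p: "?p \<in> carrier_mat m m" by simp
  have "u \<bullet>c u = 1" unfolding cscalar_prod_self u by simp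
  then have one: "(\<Sum>k<m. u $ k * cnj (u $ k)) = 1" by (simp add: cscalar_prod_sum[OF u(1) u(1)])
  have "mat_adjoint ?p = ?p"
    by (rule eq_matI) (auto simp: mat_adjoint_index[OF p])
  moreover have "?p * ?p = ?p"
  proof (rule eq_matI)
    fix i j assume "i < dim_row ?p" "j < dim_col ?p"
    then have ij: "i < m" "j < m" by auto
    have "(?p * ?p) $$ (i, j) = (\<Sum>k<m. u $ i * cnj (u $ j) * (u $ k * cnj (u $ k)))"
      unfolding mult_mat_index[OF p p ij] using ij by (intro sum.cong) auto
    also have "\<dots> = ?p $$ (i, j)"
      using ij one by (simp flip: sum_distrib_left)
    finally show "(?p * ?p) $$ (i, j) = ?p $$ (i, j)" .
  qed auto
  ultimately show ?thesis by (simp add: proj_mat_def)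
qed

lemma mat_tr_rank_one_mult:
  assumes u: "u \<in> carrier_vec m" and X: "X \<in> carrier_mat m m"
  shows "mat_tr (mat m m (\<lambda>(i, j). u $ i * cnj (u $ j)) * X) = (X *\<^sub>v u) \<bullet>c u"
proof -
  let ?p = "mat m m (\<lambda>(i, j). u $ i * cnj (u $ j))"
  have p: "?p \<in> carrier_mat m m" by simp
  have "mat_tr (?p * X) = mat_tr (X * ?p)" by (rule mat_tr_mult_commute[OF p X])
  also have "\<dots> = (\<Sum>a<m. \<Sum>b<m. X $$ (a, b) * u $ b * cnj (u $ a))"
    using X by (auto simp: mat_tr_def mult_mat_index[OF X p] mult.assoc simp del: index_mult_mat(1) intro!: sum.cong)
  finally show ?thesis by (simp only: cscalar_prod_mult_mat_vec[OF X u u])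
qed

text \<open>Polarisation: c = 1 gives the sum of the two mixed terms and c = \<i> their difference,
  so the quadratic form determines the sesquilinear form and with it every entry.\<close>

lemma mat_eqI_quadratic_form:
  assumes X: "(X :: complex mat) \<in> carrier_mat m m" and Y: "Y \<in> carrier_mat m m"
    and eq: "\<And>u. u \<in> carrier_vec m \<Longrightarrow> (X *\<^sub>v u) \<bullet>c u = (Y *\<^sub>v u) \<bullet>c u"
  shows "X = Y"
proof -
  have expand: "(Z *\<^sub>v (u + c \<cdot>\<^sub>v v)) \<bullet>c (u + c \<cdot>\<^sub>v v) = (Z *\<^sub>v u) \<bullet>c u + cnj c * ((Z *\<^sub>v u) \<bullet>c v)
     + c * ((Z *\<^sub>v v) \<bullet>c u) + c * cnj c * ((Z *\<^sub>v v) \<bullet>c v)"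
    if "u \<in> carrier_vec m" "v \<in> carrier_vec m" "Z \<in> carrier_mat m m" for u v Z c
  proof -
    have uv: "u + c \<cdot>\<^sub>v v \<in> carrier_vec m" using that by simp
    show ?thesis
      unfolding cscalar_prod_mult_mat_vec[OF that(3) uv uv] cscalar_prod_mult_mat_vec[OF that(3,1,1)]
        cscalar_prod_mult_mat_vec[OF that(3,1,2)] cscalar_prod_mult_mat_vec[OF that(3,2,1)]
        cscalar_prod_mult_mat_vec[OF that(3,2,2)] sum_distrib_left sum.distrib[symmetric]
    proof (intro sum.cong refl)
      fix a b assume "a \<in> {..<m}" "b \<in> {..<m}"
      then have "(u + c \<cdot>\<^sub>v v) $ b = u $ b + c * v $ b" "(u + c \<cdot>\<^sub>v v) $ a = u $ a + c * v $ a"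
        using carrier_vecD[OF that(2)] by auto
      then show "Z $$ (a, b) * (u + c \<cdot>\<^sub>v v) $ b * cnj ((u + c \<cdot>\<^sub>v v) $ a) =
        Z $$ (a, b) * u $ b * cnj (u $ a) + cnj c * (Z $$ (a, b) * u $ b * cnj (v $ a))
        + c * (Z $$ (a, b) * v $ b * cnj (u $ a)) + c * cnj c * (Z $$ (a, b) * v $ b * cnj (v $ a))"
        by (simp add: algebra_simps)
    qed
  qed
  have sesq: "(X *\<^sub>v v) \<bullet>c u = (Y *\<^sub>v v) \<bullet>c u" if uv: "u \<in> carrier_vec m" "v \<in> carrier_vec m" for u v
  proof -
    define x1 x2 y1 y2 where "x1 = (X *\<^sub>v u) \<bullet>c v" and "x2 = (X *\<^sub>v v) \<bullet>c u"
      and "y1 = (Y *\<^sub>v u) \<bullet>c v" and "y2 = (Y *\<^sub>v v) \<bullet>c u"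
    have *: "cnj c * x1 + c * x2 = cnj c * y1 + c * y2" for c
      using eq[of "u + c \<cdot>\<^sub>v v"] eq[of u] eq[of v] uv
      unfolding expand[OF uv X] expand[OF uv Y] x1_def x2_def y1_def y2_def by simp
    from *[of 1] have "x1 + x2 = y1 + y2" by simp
    moreover from *[of \<i>] have "\<i> * (x2 - x1) = \<i> * (y2 - y1)" by (simp add: algebra_simps)
    then have "x2 - x1 = y2 - y1" by simp
    ultimately have "(x2 - x1) + (x1 + x2) = (y2 - y1) + (y1 + y2)" by (simp only:)
    then have "2 * x2 = 2 * y2" by simp
    then show ?thesis by (simp add: x2_def y2_def)
  qed
  show ?thesis
  proof (rule eq_matI)
    fix i j assume "i < dim_row Y" "j < dim_col Y"
    then have ij: "i < m" "j < m" using Y by auto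
    have "conjugate (unit_vec m i) = (unit_vec m i :: complex vec)"
      by (rule eq_vecI) (auto simp: unit_vec_def)
    then show "X $$ (i, j) = Y $$ (i, j)"
      using sesq[of "unit_vec m i" "unit_vec m j"] X Y ij by simp
  qed (use X Y in auto)
qed

text \<open>Against the rank-one projection onto a unit vector the trace is the quadratic form at
  that vector; scaling reaches the other nonzero vectors.\<close>

lemma mat_eqI_tr_proj:
  assumes X: "X \<in> carrier_mat m m" and Y: "Y \<in> carrier_mat m m"
    and eq: "\<And>p. proj_mat m p \<Longrightarrow> mat_tr (p * X) = mat_tr (p * Y)"
  shows "X = Y"
proof (rule mat_eqI_quadratic_form[OF X Y])
  fix u :: "complex vec" assume u: "u \<in> carrier_vec m"
  show "(X *\<^sub>v u) \<bullet>c u = (Y *\<^sub>v u) \<bullet>c u"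
  proof (cases "vec_l2norm u = 0")
    case True
    then show ?thesis using vec_l2norm_eq_0[OF u True] X Y by simp
  next
    case False
    define c where "c = complex_of_real (1 / vec_l2norm u)"
    have cu: "c \<cdot>\<^sub>v u \<in> carrier_vec m" "vec_l2norm (c \<cdot>\<^sub>v u) = 1"
      using u False by (auto simp: vec_l2norm_smult c_def norm_divide)
    have "c \<noteq> 0" using False by (simp add: c_def)
    have sc: "(Z *\<^sub>v (c \<cdot>\<^sub>v u)) \<bullet>c (c \<cdot>\<^sub>v u) = c * cnj c * ((Z *\<^sub>v u) \<bullet>c u)" if "Z \<in> carrier_mat m m" for Z
      using that u by (simp add: cscalar_prod_mult_mat_vec[of _ m m] sum_distrib_left mult_ac)
    have "(X *\<^sub>v (c \<cdot>\<^sub>v u)) \<bullet>c (c \<cdot>\<^sub>v u) = (Y *\<^sub>v (c \<cdot>\<^sub>v u)) \<bullet>c (c \<cdot>\<^sub>v u)"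
      using eq[OF proj_mat_rank_one[OF cu]] unfolding mat_tr_rank_one_mult[OF cu(1) X] mat_tr_rank_one_mult[OF cu(1) Y] .
    then show ?thesis unfolding sc[OF X] sc[OF Y] using \<open>c \<noteq> 0\<close> by simp
  qed
qed

lemma proj_mat_0: "proj_mat m (0\<^sub>m m m)"
proof -
  have "mat_adjoint (0\<^sub>m m m :: complex mat) = 0\<^sub>m m m"
    by (rule eq_matI) (auto simp: mat_adjoint_index[OF zero_carrier_mat])
  then show ?thesis by (simp add: proj_mat_def)
qed

section \<open>The conditional expectation onto block diagonal elements\<close>

definition demb :: "nat \<Rightarrow> complex mat \<times> complex mat \<Rightarrow> dsum" where
  "demb r = (\<lambda>(C, D). (bdiag r C D, C))"

definition dsub :: "nat \<Rightarrow> nat \<Rightarrow> nat \<Rightarrow> dsum set" where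
  "dsub r m k = demb r ` (carrier_mat m m \<times> carrier_mat k k)"

lemma dsub_subset: "dsub r m k \<subseteq> dsum_alg (r * m + k) m"
  by (auto simp: dsub_def demb_def dsum_alg_def)

lemma ds_proj_demb:
  assumes "proj_mat m p" "proj_mat k q"
  shows "ds_proj (r * m + k) m (demb r (p, q))"
  using assms
  by (simp add: ds_proj_def demb_def proj_mat_def bdiag_adjoint[of _ m _ k] bdiag_mult[of _ m _ _ k])

lemma ds_compl_demb:
  assumes "p \<in> carrier_mat m m" "q \<in> carrier_mat k k"
  shows "ds_compl (r * m + k) m (demb r (p, q)) = demb r (1\<^sub>m m - p, 1\<^sub>m k - q)"
  using assms by (simp add: ds_compl_def demb_def bdiag_one_minus)

lemma wtr_demb:
  assumes "C \<in> carrier_mat m m" "D \<in> carrier_mat k k"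
  shows "wtr w1 w2 (demb r (C, D)) = of_real (real r * w1 + w2) * mat_tr C + of_real w1 * mat_tr D"
  using assms by (simp add: wtr_def demb_def bdiag_tr algebra_simps)

lemma opnorm_demb:
  assumes "C \<in> carrier_mat m m" "D \<in> carrier_mat k k"
  shows "opnorm (demb r (C, D)) = max (mat_opnorm C) (mat_opnorm D)"
  using mat_opnorm_bdiag[OF assms, of r] mat_opnorm_bdiag_last[OF assms, of r]
  by (simp add: opnorm_def demb_def)

text \<open>Both coefficients in \<open>wtr_demb\<close> are positive. Taking p or q to be the zero
  projection isolates D or C, and traces against projections separate matrices.\<close>

lemma dsub_eqI:
  assumes b: "b \<in> dsub r m k" "b' \<in> dsub r m k" and w: "0 < w1" "0 \<le> w2" and r: "0 < r"
    and eq: "\<And>p q. proj_mat m p \<Longrightarrow> proj_mat k q \<Longrightarrow>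
      wtr w1 w2 (ds_mult (demb r (p, q)) b) = wtr w1 w2 (ds_mult (demb r (p, q)) b')"
  shows "b = b'"
proof -
  obtain C D where C: "C \<in> carrier_mat m m" and D: "D \<in> carrier_mat k k" and b_eq: "b = demb r (C, D)"
    using b by (auto simp: dsub_def)
  obtain C' D' where C': "C' \<in> carrier_mat m m" and D': "D' \<in> carrier_mat k k" and b'_eq: "b' = demb r (C', D')"
    using b by (auto simp: dsub_def)
  have s: "real r * w1 + w2 > 0" using w r by (intro add_pos_nonneg) auto
  have form: "wtr w1 w2 (ds_mult (demb r (p, q)) (demb r (X, Y)))
      = of_real (real r * w1 + w2) * mat_tr (p * X) + of_real w1 * mat_tr (q * Y)"
    if "proj_mat m p" "proj_mat k q" "X \<in> carrier_mat m m" "Y \<in> carrier_mat k k" for p q X Y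
  proof -
    have c: "p \<in> carrier_mat m m" "q \<in> carrier_mat k k" using that by (auto simp: proj_mat_def)
    have "ds_mult (demb r (p, q)) (demb r (X, Y)) = demb r (p * X, q * Y)"
      using c that by (simp add: ds_mult_def demb_def bdiag_mult)
    then show ?thesis using wtr_demb[of "p * X" m "q * Y" k] c that by simp
  qed
  have tr0: "mat_tr (0\<^sub>m j j * X) = 0" if "X \<in> carrier_mat j j" for j X
    using that by (simp add: mat_tr_def)
  have "C = C'"
  proof (rule mat_eqI_tr_proj[OF C C'])
    fix p assume "proj_mat m p"
    from eq[OF this proj_mat_0] form[OF this proj_mat_0 C D] form[OF this proj_mat_0 C' D']
    show "mat_tr (p * C) = mat_tr (p * C')"
      using s by (simp add: b_eq b'_eq tr0[OF D] tr0[OF D'] del: of_real_add of_real_mult)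
  qed
  moreover have "D = D'"
  proof (rule mat_eqI_tr_proj[OF D D'])
    fix q assume "proj_mat k q"
    from eq[OF proj_mat_0 this] form[OF proj_mat_0 this C D] form[OF proj_mat_0 this C' D']
    show "mat_tr (q * D) = mat_tr (q * D')"
      using w by (simp add: b_eq b'_eq tr0[OF C] tr0[OF C'])
  qed
  ultimately show ?thesis by (simp add: b_eq b'_eq)
qed

text \<open>By \<open>cond_exp_tr_proj\<close> the trace of e P(a) equals that of a e, which does
  not involve P, and the projections e of the subalgebra separate its elements.\<close>

lemma cond_exp_unique:
  assumes P: "is_cond_exp (dsum_alg (r * m + k) m) (dsub r m k) P"
      "\<And>a. a \<in> dsum_alg (r * m + k) m \<Longrightarrow> wtr w1 w2 (P a) = wtr w1 w2 a"
    and Q: "is_cond_exp (dsum_alg (r * m + k) m) (dsub r m k) Q"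
      "\<And>a. a \<in> dsum_alg (r * m + k) m \<Longrightarrow> wtr w1 w2 (Q a) = wtr w1 w2 a"
    and a: "a \<in> dsum_alg (r * m + k) m" and w: "0 < w1" "0 \<le> w2" and r: "0 < r"
  shows "P a = Q a"
proof (rule dsub_eqI[OF _ _ w r])
  show "P a \<in> dsub r m k" "Q a \<in> dsub r m k"
    using P(1) Q(1) a by (auto simp: is_cond_exp_def)
  fix p q assume pq: "proj_mat m p" "proj_mat k q"
  then have c: "p \<in> carrier_mat m m" "q \<in> carrier_mat k k" by (auto simp: proj_mat_def)
  have e: "demb r (p, q) \<in> dsub r m k" "ds_compl (r * m + k) m (demb r (p, q)) \<in> dsub r m k"
    unfolding ds_compl_demb[OF c] using c by (auto simp: dsub_def intro!: minus_carrier_mat)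
  note * = cond_exp_tr_proj[OF _ dsub_subset _ ds_proj_demb[OF pq] e a less_imp_le[OF w(1)] w(2)]
  show "wtr w1 w2 (ds_mult (demb r (p, q)) (P a)) = wtr w1 w2 (ds_mult (demb r (p, q)) (Q a))"
    using *[OF P] *[OF Q] by simp
qed

definition avg_block :: "nat \<Rightarrow> nat \<Rightarrow> real \<Rightarrow> real \<Rightarrow> dsum \<Rightarrow> complex mat" where
  "avg_block r m w1 w2 a = mat m m (\<lambda>(x, y).
     (of_real w1 * (\<Sum>\<beta><r. fst a $$ (\<beta> * m + x, \<beta> * m + y)) + of_real w2 * snd a $$ (x, y))
       / of_real (real r * w1 + w2))"

definition last_block :: "nat \<Rightarrow> nat \<Rightarrow> nat \<Rightarrow> dsum \<Rightarrow> complex mat" where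
  "last_block r m k a = mat k k (\<lambda>(x, y). fst a $$ (r * m + x, r * m + y))"

definition block_exp :: "nat \<Rightarrow> nat \<Rightarrow> nat \<Rightarrow> real \<Rightarrow> real \<Rightarrow> dsum \<Rightarrow> dsum" where
  "block_exp r m k w1 w2 a = demb r (avg_block r m w1 w2 a, last_block r m k a)"

context
  fixes r m k :: nat and w1 w2 :: real
  assumes w1: "0 < w1" and w2: "0 < w2" and r: "0 < r"
begin

lemma weight_sum_pos: "0 < real r * w1 + w2"
  using w1 w2 r by (simp add: add_pos_pos)

lemma block_carriers [simp]:
  "avg_block r m w1 w2 a \<in> carrier_mat m m" "last_block r m k a \<in> carrier_mat k k"
  by (simp_all add: avg_block_def last_block_def)

lemma block_le:
  assumes "\<beta> < r"
  shows "\<beta> * m + m \<le> r * m + k"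
proof -
  have "Suc \<beta> * m \<le> r * m" using assms by (intro mult_le_mono1) simp
  then show ?thesis by simp
qed

text \<open>Exhibits the average as a convex combination of compressions of a. Contractivity and the
  lower bound for \<open>a^* a\<close> are both read off this form.\<close>

lemma avg_block_form:
  assumes a: "a \<in> dsum_alg (r * m + k) m" and u: "u \<in> carrier_vec m" and v: "v \<in> carrier_vec m"
  shows "(avg_block r m w1 w2 a *\<^sub>v u) \<bullet>c v
    = (of_real w1 * (\<Sum>\<beta><r. (fst a *\<^sub>v inj_vec (r * m + k) (\<beta> * m) u) \<bullet>c inj_vec (r * m + k) (\<beta> * m) v)
        + of_real w2 * ((snd a *\<^sub>v u) \<bullet>c v)) / of_real (real r * w1 + w2)"
proof -
  have c: "fst a \<in> carrier_mat (r * m + k) (r * m + k)" "snd a \<in> carrier_mat m m" using a by (auto simp: dsum_alg_def)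
  have "(\<Sum>\<beta><r. (fst a *\<^sub>v inj_vec (r * m + k) (\<beta> * m) u) \<bullet>c inj_vec (r * m + k) (\<beta> * m) v)
      = (\<Sum>\<beta><r. \<Sum>x<m. \<Sum>y<m. fst a $$ (\<beta> * m + x, \<beta> * m + y) * u $ y * cnj (v $ x))"
    by (intro sum.cong refl cscalar_prod_inj_vec[OF c(1) u v block_le]) simp
  also have "\<dots> = (\<Sum>x<m. \<Sum>y<m. \<Sum>\<beta><r. fst a $$ (\<beta> * m + x, \<beta> * m + y) * u $ y * cnj (v $ x))"
    by (subst sum.swap, intro sum.cong refl sum.swap)
  finally have S: "(\<Sum>\<beta><r. (fst a *\<^sub>v inj_vec (r * m + k) (\<beta> * m) u) \<bullet>c inj_vec (r * m + k) (\<beta> * m) v)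
      = (\<Sum>x<m. \<Sum>y<m. (\<Sum>\<beta><r. fst a $$ (\<beta> * m + x, \<beta> * m + y)) * u $ y * cnj (v $ x))"
    by (simp only: sum_distrib_right)
  show ?thesis
    unfolding S cscalar_prod_mult_mat_vec[OF block_carriers(1) u v] cscalar_prod_mult_mat_vec[OF c(2) u v]
      sum_distrib_left sum.distrib[symmetric] sum_divide_distrib
  proof (intro sum.cong refl)
    fix x y assume "x \<in> {..<m}" "y \<in> {..<m}"
    then show "avg_block r m w1 w2 a $$ (x, y) * u $ y * cnj (v $ x) =
      (of_real w1 * ((\<Sum>\<beta><r. fst a $$ (\<beta> * m + x, \<beta> * m + y)) * u $ y * cnj (v $ x))
        + of_real w2 * (snd a $$ (x, y) * u $ y * cnj (v $ x))) / of_real (real r * w1 + w2)"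
      by (simp add: avg_block_def add_divide_distrib distrib_right mult.assoc)
  qed
qed

lemma last_block_form:
  assumes a: "a \<in> dsum_alg (r * m + k) m" and u: "u \<in> carrier_vec k" and v: "v \<in> carrier_vec k"
  shows "(last_block r m k a *\<^sub>v u) \<bullet>c v = (fst a *\<^sub>v inj_vec (r * m + k) (r * m) u) \<bullet>c inj_vec (r * m + k) (r * m) v"
proof -
  have c: "fst a \<in> carrier_mat (r * m + k) (r * m + k)" using a by (auto simp: dsum_alg_def)
  show ?thesis
    unfolding cscalar_prod_inj_vec[OF c u v order.refl] cscalar_prod_mult_mat_vec[OF block_carriers(2) u v]
    by (intro sum.cong refl) (simp add: last_block_def)
qed

lemma opnorm_block_exp:
  assumes a: "a \<in> dsum_alg (r * m + k) m"
  shows "opnorm (block_exp r m k w1 w2 a) \<le> opnorm a"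
proof -
  have c: "fst a \<in> carrier_mat (r * m + k) (r * m + k)" "snd a \<in> carrier_mat m m" using a by (auto simp: dsum_alg_def)
  let ?K = "opnorm a"
  have fst_le: "cmod ((fst a *\<^sub>v inj_vec (r * m + k) p u) \<bullet>c inj_vec (r * m + k) p v) \<le> ?K * (vec_l2norm u * vec_l2norm v)"
    if "u \<in> carrier_vec l" "v \<in> carrier_vec l" "p + l \<le> r * m + k" for p l u v
  proof -
    have "cmod ((fst a *\<^sub>v inj_vec (r * m + k) p u) \<bullet>c inj_vec (r * m + k) p v)
        \<le> mat_opnorm (fst a) * (vec_l2norm (inj_vec (r * m + k) p u) * vec_l2norm (inj_vec (r * m + k) p v))"
      by (rule cscalar_prod_mat_opnorm[OF c(1)]) auto
    also have "\<dots> = mat_opnorm (fst a) * (vec_l2norm u * vec_l2norm v)"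
      using that by (simp add: inj_vec_l2norm)
    also have "\<dots> \<le> ?K * (vec_l2norm u * vec_l2norm v)"
      by (intro mult_right_mono) (auto simp: opnorm_def)
    finally show ?thesis .
  qed
  have "mat_opnorm (avg_block r m w1 w2 a) \<le> ?K"
  proof (rule mat_opnorm_leI_cscalar_prod[OF block_carriers(1) opnorm_nonneg])
    fix u v :: "complex vec" assume u: "u \<in> carrier_vec m" and v: "v \<in> carrier_vec m"
    let ?N = "?K * (vec_l2norm u * vec_l2norm v)"
    let ?f = "\<lambda>\<beta>. (fst a *\<^sub>v inj_vec (r * m + k) (\<beta> * m) u) \<bullet>c inj_vec (r * m + k) (\<beta> * m) v"
    have "cmod (\<Sum>\<beta><r. ?f \<beta>) \<le> (\<Sum>\<beta><r. ?N)"
      by (intro sum_norm_le fst_le[OF u v block_le]) simp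
    moreover have "cmod ((snd a *\<^sub>v u) \<bullet>c v) \<le> ?N"
      using cscalar_prod_mat_opnorm[OF c(2) u v]
      by (rule order.trans) (auto simp: opnorm_def intro!: mult_right_mono)
    ultimately have "w1 * cmod (\<Sum>\<beta><r. ?f \<beta>) + w2 * cmod ((snd a *\<^sub>v u) \<bullet>c v) \<le> w1 * (real r * ?N) + w2 * ?N"
      using w1 w2 by (intro add_mono mult_left_mono) auto
    moreover have "cmod (of_real w1 * (\<Sum>\<beta><r. ?f \<beta>) + of_real w2 * ((snd a *\<^sub>v u) \<bullet>c v))
        \<le> w1 * cmod (\<Sum>\<beta><r. ?f \<beta>) + w2 * cmod ((snd a *\<^sub>v u) \<bullet>c v)"
      using w1 w2 by (intro norm_triangle_le) (simp add: norm_mult)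
    ultimately have "cmod (of_real w1 * (\<Sum>\<beta><r. ?f \<beta>) + of_real w2 * ((snd a *\<^sub>v u) \<bullet>c v)) \<le> (real r * w1 + w2) * ?N"
      by (simp add: algebra_simps)
    then show "cmod ((avg_block r m w1 w2 a *\<^sub>v u) \<bullet>c v) \<le> ?N"
      unfolding avg_block_form[OF a u v] norm_divide norm_of_real using weight_sum_pos
      by (simp add: divide_le_eq mult.commute)
  qed
  moreover have "mat_opnorm (last_block r m k a) \<le> ?K"
    by (rule mat_opnorm_leI_cscalar_prod[OF block_carriers(2) opnorm_nonneg])
      (simp add: last_block_form[OF a] fst_le)
  ultimately show ?thesis
    unfolding block_exp_def opnorm_demb[OF block_carriers] by simp
qed

lemma block_exp_is_cond_exp: "is_cond_exp (dsum_alg (r * m + k) m) (dsub r m k) (block_exp r m k w1 w2)"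
  unfolding is_cond_exp_def
proof (intro conjI ballI allI)
  show "block_exp r m k w1 w2 \<in> dsum_alg (r * m + k) m \<rightarrow> dsub r m k"
    by (auto simp: block_exp_def dsub_def)
next
  fix a b assume ab: "a \<in> dsum_alg (r * m + k) m" "b \<in> dsum_alg (r * m + k) m"
  then have c: "fst a \<in> carrier_mat (r * m + k) (r * m + k)" "snd a \<in> carrier_mat m m" "fst b \<in> carrier_mat (r * m + k) (r * m + k)" "snd b \<in> carrier_mat m m"
    by (auto simp: dsum_alg_def)
  have "avg_block r m w1 w2 (ds_add a b) = avg_block r m w1 w2 a + avg_block r m w1 w2 b"
  proof (rule eq_matI)
    fix x y assume "x < dim_row (avg_block r m w1 w2 a + avg_block r m w1 w2 b)"
      "y < dim_col (avg_block r m w1 w2 a + avg_block r m w1 w2 b)"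
    then have xy: "x < m" "y < m" by (auto simp: avg_block_def)
    have "(fst a + fst b) $$ (\<beta> * m + x, \<beta> * m + y)
        = fst a $$ (\<beta> * m + x, \<beta> * m + y) + fst b $$ (\<beta> * m + x, \<beta> * m + y)" if "\<beta> < r" for \<beta>
      using block_le[OF that] xy c by (subst index_add_mat(1)) auto
    then have "(\<Sum>\<beta><r. (fst a + fst b) $$ (\<beta> * m + x, \<beta> * m + y))
        = (\<Sum>\<beta><r. fst a $$ (\<beta> * m + x, \<beta> * m + y)) + (\<Sum>\<beta><r. fst b $$ (\<beta> * m + x, \<beta> * m + y))"
      by (simp add: sum.distrib)
    then show "avg_block r m w1 w2 (ds_add a b) $$ (x, y) = (avg_block r m w1 w2 a + avg_block r m w1 w2 b) $$ (x, y)"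
      using xy c by (simp add: avg_block_def ds_add_def algebra_simps add_divide_distrib)
  qed (auto simp: avg_block_def)
  moreover have "last_block r m k (ds_add a b) = last_block r m k a + last_block r m k b"
    using c by (intro eq_matI) (auto simp: last_block_def ds_add_def)
  ultimately show "block_exp r m k w1 w2 (ds_add a b) = ds_add (block_exp r m k w1 w2 a) (block_exp r m k w1 w2 b)"
    by (simp add: block_exp_def demb_def ds_add_def bdiag_add[OF block_carriers(1,1) block_carriers(2,2)])
next
  fix c a assume a: "a \<in> dsum_alg (r * m + k) m"
  then have ca: "fst a \<in> carrier_mat (r * m + k) (r * m + k)" "snd a \<in> carrier_mat m m"
    by (auto simp: dsum_alg_def)
  have "avg_block r m w1 w2 (ds_scale c a) = c \<cdot>\<^sub>m avg_block r m w1 w2 a"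
  proof (rule eq_matI)
    fix x y assume "x < dim_row (c \<cdot>\<^sub>m avg_block r m w1 w2 a)" "y < dim_col (c \<cdot>\<^sub>m avg_block r m w1 w2 a)"
    then have xy: "x < m" "y < m" by (auto simp: avg_block_def)
    have "(c \<cdot>\<^sub>m fst a) $$ (\<beta> * m + x, \<beta> * m + y) = c * fst a $$ (\<beta> * m + x, \<beta> * m + y)" if "\<beta> < r" for \<beta>
      using block_le[OF that] xy ca by (subst index_smult_mat(1)) auto
    then have "(\<Sum>\<beta><r. (c \<cdot>\<^sub>m fst a) $$ (\<beta> * m + x, \<beta> * m + y))
        = c * (\<Sum>\<beta><r. fst a $$ (\<beta> * m + x, \<beta> * m + y))"
      by (simp add: sum_distrib_left)
    then show "avg_block r m w1 w2 (ds_scale c a) $$ (x, y) = (c \<cdot>\<^sub>m avg_block r m w1 w2 a) $$ (x, y)"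
      using xy ca by (simp add: avg_block_def ds_scale_def algebra_simps add_divide_distrib)
  qed (auto simp: avg_block_def)
  moreover have "last_block r m k (ds_scale c a) = c \<cdot>\<^sub>m last_block r m k a"
    using ca by (intro eq_matI) (auto simp: last_block_def ds_scale_def)
  ultimately show "block_exp r m k w1 w2 (ds_scale c a) = ds_scale c (block_exp r m k w1 w2 a)"
    by (simp add: block_exp_def demb_def ds_scale_def bdiag_smult[OF block_carriers])
next
  fix b assume "b \<in> dsub r m k"
  then obtain C D where C: "C \<in> carrier_mat m m" and D: "D \<in> carrier_mat k k" and b: "b = demb r (C, D)"
    by (auto simp: dsub_def)
  have "avg_block r m w1 w2 b = C"
  proof (rule eq_matI)
    fix x y assume "x < dim_row C" "y < dim_col C"
    then have xy: "x < m" "y < m" using C by auto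
    have "avg_block r m w1 w2 b $$ (x, y) = (of_real w1 * (of_nat r * C $$ (x, y)) + of_real w2 * C $$ (x, y)) / of_real (real r * w1 + w2)"
      using xy by (simp add: avg_block_def b demb_def bdiag_index_block[OF C D])
    also have "\<dots> = of_real (real r * w1 + w2) * C $$ (x, y) / of_real (real r * w1 + w2)" by (simp add: algebra_simps)
    also have "\<dots> = C $$ (x, y)" using weight_sum_pos by (simp del: of_real_add of_real_mult)
    finally show "avg_block r m w1 w2 b $$ (x, y) = C $$ (x, y)" .
  qed (use C in \<open>auto simp: avg_block_def\<close>)
  moreover have "last_block r m k b = D"
    using D by (intro eq_matI) (auto simp: last_block_def b demb_def bdiag_index_last[OF C D])
  ultimately show "block_exp r m k w1 w2 b = b" by (simp add: block_exp_def b)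
next
  show "opnorm (block_exp r m k w1 w2 a) \<le> opnorm a" if "a \<in> dsum_alg (r * m + k) m" for a
    by (rule opnorm_block_exp[OF that])
qed

text \<open>Inside \<open>demb\<close> the mean counts with weight r w1 + w2, by
  \<open>wtr_demb\<close>, which is exactly the denominator in \<open>avg_block\<close>.\<close>

lemma wtr_block_exp:
  assumes a: "a \<in> dsum_alg (r * m + k) m"
  shows "wtr w1 w2 (block_exp r m k w1 w2 a) = wtr w1 w2 a"
proof -
  have c: "fst a \<in> carrier_mat (r * m + k) (r * m + k)" "snd a \<in> carrier_mat m m" using a by (auto simp: dsum_alg_def)
  have "mat_tr (avg_block r m w1 w2 a) = (of_real w1 * (\<Sum>x<m. \<Sum>\<beta><r. fst a $$ (\<beta> * m + x, \<beta> * m + x))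
      + of_real w2 * mat_tr (snd a)) / of_real (real r * w1 + w2)"
    unfolding sum_distrib_left mat_tr_def carrier_matD(1)[OF c(2)] sum.distrib[symmetric] sum_divide_distrib
    by (intro sum.cong) (auto simp: avg_block_def sum_distrib_left)
  then have "of_real (real r * w1 + w2) * mat_tr (avg_block r m w1 w2 a)
      = of_real w1 * (\<Sum>\<beta><r. \<Sum>x<m. fst a $$ (\<beta> * m + x, \<beta> * m + x)) + of_real w2 * mat_tr (snd a)"
    using weight_sum_pos by (subst sum.swap) (simp del: of_real_add of_real_mult)
  moreover have "mat_tr (last_block r m k a) = (\<Sum>x<k. fst a $$ (r * m + x, r * m + x))"
    by (simp add: mat_tr_def last_block_def)
  moreover have "mat_tr (fst a) = (\<Sum>\<beta><r. \<Sum>x<m. fst a $$ (\<beta> * m + x, \<beta> * m + x)) + (\<Sum>x<k. fst a $$ (r * m + x, r * m + x))"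
    using c by (simp add: mat_tr_def sum_lessThan_add sum_lessThan_blocks)
  ultimately show ?thesis
    unfolding block_exp_def wtr_demb[OF block_carriers] by (simp add: wtr_def algebra_simps)
qed

text \<open>The description in \<open>cond_exp\<close> selects among extensional functions, so the
  witness is \<open>block_exp\<close> restricted to the algebra.\<close>

lemma cond_exp_eq_block_exp:
  assumes a: "a \<in> dsum_alg (r * m + k) m"
  shows "cond_exp (dsum_alg (r * m + k) m) (dsub r m k) (wtr w1 w2) a = block_exp r m k w1 w2 a"
proof -
  let ?A = "dsum_alg (r * m + k) m"
  let ?P = "restrict (block_exp r m k w1 w2) ?A"
  have "cond_exp ?A (dsub r m k) (wtr w1 w2) = ?P"
    unfolding cond_exp_def
  proof (rule the_equality)
    have "is_cond_exp ?A (dsub r m k) ?P"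
      using block_exp_is_cond_exp dsub_subset[of r m k]
      by (auto simp: is_cond_exp_def dsum_alg_closed Pi_iff)
    then show "?P \<in> extensional ?A \<and> is_cond_exp ?A (dsub r m k) ?P \<and> (\<forall>a\<in>?A. wtr w1 w2 (?P a) = wtr w1 w2 a)"
      by (simp add: wtr_block_exp)
    fix Q assume Q: "Q \<in> extensional ?A \<and> is_cond_exp ?A (dsub r m k) Q \<and> (\<forall>a\<in>?A. wtr w1 w2 (Q a) = wtr w1 w2 a)"
    show "Q = ?P"
    proof (rule extensionalityI[of _ ?A])
      fix a assume "a \<in> ?A"
      then show "Q a = ?P a"
        using cond_exp_unique[OF _ _ block_exp_is_cond_exp wtr_block_exp _ w1 less_imp_le[OF w2] r, of Q a] Q by simp
    qed (use Q in auto)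
  qed
  then show ?thesis using a by simp
qed

lemma opnorm_star_mult:
  assumes a: "a \<in> dsum_alg (r * m + k) m"
  shows "opnorm (ds_mult (ds_star a) a) \<le> (opnorm a)\<^sup>2"
proof -
  have *: "mat_opnorm (mat_adjoint A * A) \<le> K\<^sup>2" if "A \<in> carrier_mat j j" "mat_opnorm A \<le> K" for A j K
  proof -
    have "mat_opnorm (mat_adjoint A * A) \<le> mat_opnorm (mat_adjoint A) * mat_opnorm A"
      using that by (intro mat_opnorm_mult[of _ j j]) auto
    also have "\<dots> \<le> K * K"
      using that mat_opnorm_adjoint[OF that(1)] mat_opnorm_nonneg[of A] mat_opnorm_nonneg[of "mat_adjoint A"]
      by (intro mult_mono) linarith+
    finally show ?thesis by (simp add: power2_eq_square)
  qed
  have c: "fst a \<in> carrier_mat (r * m + k) (r * m + k)" "snd a \<in> carrier_mat m m" using a by (auto simp: dsum_alg_def)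
  show ?thesis
    using *[OF c(1), of "opnorm a"] *[OF c(2), of "opnorm a"]
    by (simp add: opnorm_def[of "(_, _)"] ds_mult_def ds_star_def) (simp add: opnorm_def)
qed

text \<open>At u, the form of the averaged \<open>a^* a\<close> is a weighted mean of squared norms
  of a on the copies of u. All terms are nonnegative and each weight is at least w2, so a single
  term is at most (r w1 + w2) / w2 times the mean.\<close>

lemma opnorm_le_block_exp:
  assumes a: "a \<in> dsum_alg (r * m + k) m" and w21: "w2 \<le> w1"
  shows "opnorm a \<le> (real r + 1) * sqrt ((real r * w1 + w2) / w2 * opnorm (block_exp r m k w1 w2 (ds_mult (ds_star a) a)))"
proof -
  define G where "G = ds_mult (ds_star a) a"
  define M where "M = opnorm (block_exp r m k w1 w2 G)"
  have GA: "G \<in> dsum_alg (r * m + k) m" unfolding G_def by (intro dsum_alg_closed a)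
  have c: "fst a \<in> carrier_mat (r * m + k) (r * m + k)" "snd a \<in> carrier_mat m m" using a by (auto simp: dsum_alg_def)
  have G: "fst G = mat_adjoint (fst a) * fst a" "snd G = mat_adjoint (snd a) * snd a"
    by (simp_all add: G_def ds_mult_def ds_star_def)
  have M0: "0 \<le> M" by (simp add: M_def opnorm_nonneg)
  have M: "mat_opnorm (avg_block r m w1 w2 G) \<le> M" "mat_opnorm (last_block r m k G) \<le> M"
    unfolding M_def block_exp_def opnorm_demb[OF block_carriers] by auto
  \<comment> \<open>L bounds a on a single block: M scaled by total weight over least weight, with a
    square root because \<open>a^* a\<close> is quadratic in a.\<close>
  define L where "L = sqrt ((real r * w1 + w2) / w2 * M)"
  have L: "0 \<le> L" "L\<^sup>2 = (real r * w1 + w2) / w2 * M" using weight_sum_pos w2 M0 by (simp_all add: L_def)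
  have avg: "w1 * (\<Sum>\<beta><r. (vec_l2norm (fst a *\<^sub>v inj_vec (r * m + k) (\<beta> * m) u))\<^sup>2) + w2 * (vec_l2norm (snd a *\<^sub>v u))\<^sup>2
      \<le> (real r * w1 + w2) * M * (vec_l2norm u)\<^sup>2" if u: "u \<in> carrier_vec m" for u
  proof -
    let ?t = "w1 * (\<Sum>\<beta><r. (vec_l2norm (fst a *\<^sub>v inj_vec (r * m + k) (\<beta> * m) u))\<^sup>2) + w2 * (vec_l2norm (snd a *\<^sub>v u))\<^sup>2"
    have t: "0 \<le> ?t" using w1 w2 by (simp add: sum_nonneg)
    have "(avg_block r m w1 w2 G *\<^sub>v u) \<bullet>c u = complex_of_real (?t / (real r * w1 + w2))"
      unfolding avg_block_form[OF GA u u] G cscalar_prod_gram[OF c(1) inj_vec_carrier] cscalar_prod_gram[OF c(2) u]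
      by simp
    then have "?t / (real r * w1 + w2) = cmod ((avg_block r m w1 w2 G *\<^sub>v u) \<bullet>c u)"
      using t weight_sum_pos by (simp only: norm_of_real) simp
    also have "\<dots> \<le> mat_opnorm (avg_block r m w1 w2 G) * (vec_l2norm u * vec_l2norm u)"
      by (rule cscalar_prod_mat_opnorm[OF block_carriers(1) u u])
    also have "\<dots> \<le> M * (vec_l2norm u * vec_l2norm u)"
      by (intro mult_right_mono M) simp
    finally show ?thesis using weight_sum_pos by (simp add: divide_le_eq power2_eq_square mult_ac)
  qed
  have sqL: "x \<le> L * vec_l2norm u" if "w2 * x\<^sup>2 \<le> (real r * w1 + w2) * M * (vec_l2norm u)\<^sup>2" for x u
  proof (rule power2_le_imp_le)
    show "x\<^sup>2 \<le> (L * vec_l2norm u)\<^sup>2"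
      using that w2 unfolding power_mult_distrib L(2) by (simp add: field_simps)
    show "0 \<le> L * vec_l2norm u" using L by simp
  qed
  have "mat_opnorm (fst a) \<le> (real r + 1) * L"
  proof (rule mat_opnorm_le_blocks[OF c(1) L(1)])
    fix \<beta> u assume \<beta>: "\<beta> < r" and u: "(u :: complex vec) \<in> carrier_vec m"
    let ?x = "\<lambda>\<beta>. (vec_l2norm (fst a *\<^sub>v inj_vec (r * m + k) (\<beta> * m) u))\<^sup>2"
    have "w2 * ?x \<beta> \<le> w1 * ?x \<beta>" using w21 by (simp add: mult_right_mono)
    also have "\<dots> \<le> w1 * (\<Sum>\<beta><r. ?x \<beta>)"
      using w1 \<beta> by (intro mult_left_mono member_le_sum) auto
    also have "\<dots> \<le> w1 * (\<Sum>\<beta><r. ?x \<beta>) + w2 * (vec_l2norm (snd a *\<^sub>v u))\<^sup>2"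
      using w2 by simp
    also have "\<dots> \<le> (real r * w1 + w2) * M * (vec_l2norm u)\<^sup>2" by (rule avg[OF u])
    finally show "vec_l2norm (fst a *\<^sub>v inj_vec (r * m + k) (\<beta> * m) u) \<le> L * vec_l2norm u"
      by (rule sqL)
  next
    fix u :: "complex vec" assume u: "u \<in> carrier_vec k"
    let ?x = "vec_l2norm (fst a *\<^sub>v inj_vec (r * m + k) (r * m) u)"
    have "?x\<^sup>2 = cmod ((last_block r m k G *\<^sub>v u) \<bullet>c u)"
      unfolding last_block_form[OF GA u u] G cscalar_prod_gram[OF c(1) inj_vec_carrier] norm_of_real by simp
    also have "\<dots> \<le> mat_opnorm (last_block r m k G) * (vec_l2norm u * vec_l2norm u)"
      by (rule cscalar_prod_mat_opnorm[OF block_carriers(2) u u])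
    also have "\<dots> \<le> M * (vec_l2norm u * vec_l2norm u)"
      by (intro mult_right_mono M) simp
    finally have "w2 * ?x\<^sup>2 \<le> w2 * (M * (vec_l2norm u)\<^sup>2)"
      using w2 by (simp add: power2_eq_square)
    \<comment> \<open>The last block is not averaged and satisfies the better bound with M alone;
      the ratio (r w1 + w2) / w2 is at least 1, so it fits under the common L.\<close>
    also have "\<dots> \<le> (real r * w1 + w2) * (M * (vec_l2norm u)\<^sup>2)"
      using w1 M0 by (intro mult_right_mono) auto
    finally show "?x \<le> L * vec_l2norm u" by (intro sqL) (simp add: mult.assoc)
  qed
  moreover have "mat_opnorm (snd a) \<le> L"
  proof (rule mat_opnorm_leI[OF c(2) L(1)])
    fix u :: "complex vec" assume u: "u \<in> carrier_vec m"
    have "w2 * (vec_l2norm (snd a *\<^sub>v u))\<^sup>2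
        \<le> w1 * (\<Sum>\<beta><r. (vec_l2norm (fst a *\<^sub>v inj_vec (r * m + k) (\<beta> * m) u))\<^sup>2) + w2 * (vec_l2norm (snd a *\<^sub>v u))\<^sup>2"
      using w1 by (simp add: sum_nonneg)
    also have "\<dots> \<le> (real r * w1 + w2) * M * (vec_l2norm u)\<^sup>2" by (rule avg[OF u])
    finally show "vec_l2norm (snd a *\<^sub>v u) \<le> L * vec_l2norm u" by (rule sqL)
  qed
  moreover have "L \<le> (real r + 1) * L" using L(1) by (simp add: distrib_right)
  ultimately show ?thesis unfolding opnorm_def[of a] L_def M_def G_def by linarith
qed

end

section \<open>Frobenius--Rieffel norms\<close>

text \<open>At j = 0 truncated subtraction would return \<open>cf_den \<theta> 0\<close>, which is
  1; the value 0 is q_{-1}, the size of the remainder block for N = 1.\<close>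

definition cf_den_prev :: "real \<Rightarrow> nat \<Rightarrow> nat" where
  "cf_den_prev \<theta> j = (if j = 0 then 0 else cf_den \<theta> (j - 1))"

context
  fixes \<theta> :: real and j :: nat
  assumes \<theta>: "\<theta> \<in> {0<..<1} - \<rat>"
begin

lemma cf_den_Suc_eq: "cf_den \<theta> (Suc j) = cf_term \<theta> (Suc j) * cf_den \<theta> j + cf_den_prev \<theta> j"
  by (cases j) (simp_all add: cf_den_prev_def)

lemma AF_eq_dsum_alg:
  "AF \<theta> (Suc j) = dsum_alg (cf_term \<theta> (Suc j) * cf_den \<theta> j + cf_den_prev \<theta> j) (cf_den \<theta> j)"
  unfolding cf_den_Suc_eq[symmetric] by (simp add: AF_def dsum_alg_def)

text \<open>For \<open>j = 0\<close> the remainder block has size \<open>0\<close>, so the image of the scalars has the same block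
  form as the later subalgebras.\<close>

lemma AF_sub_eq_dsub: "AF_sub \<theta> (Suc j) = dsub (cf_term \<theta> (Suc j)) (cf_den \<theta> j) (cf_den_prev \<theta> j)"
proof (cases j)
  case 0
  have emb: "demb (cf_term \<theta> 1) (C, D) = AF_emb0 \<theta> (C $$ (0, 0))"
    if "C \<in> carrier_mat 1 1" "D \<in> carrier_mat 0 0" for C D
  proof -
    \<comment> \<open>D is empty and so equals every multiple of the empty identity; with the entry
      of C as factor, the whole block matrix becomes one scalar multiple of the identity.\<close>
    have C: "C = C $$ (0, 0) \<cdot>\<^sub>m 1\<^sub>m 1" and D: "D = C $$ (0, 0) \<cdot>\<^sub>m 1\<^sub>m 0"
      using that by (auto intro!: eq_matI)
    have "bdiag (cf_term \<theta> 1) C D = C $$ (0, 0) \<cdot>\<^sub>m bdiag (cf_term \<theta> 1) (1\<^sub>m 1) (1\<^sub>m 0)"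
      unfolding bdiag_smult[OF one_carrier_mat one_carrier_mat] by (rule arg_cong2[OF C D])
    then show ?thesis using C by (simp add: demb_def AF_emb0_def bdiag_one)
  qed
  have "range (AF_emb0 \<theta>) = demb (cf_term \<theta> 1) ` (carrier_mat 1 1 \<times> carrier_mat 0 0)"
  proof (intro equalityI subsetI)
    fix x assume "x \<in> range (AF_emb0 \<theta>)"
    then obtain c where "x = AF_emb0 \<theta> c" by auto
    then have "x = demb (cf_term \<theta> 1) (mat 1 1 (\<lambda>_. c), 0\<^sub>m 0 0)" using emb[of "mat 1 1 (\<lambda>_. c)" "0\<^sub>m 0 0"] by simp
    then show "x \<in> demb (cf_term \<theta> 1) ` (carrier_mat 1 1 \<times> carrier_mat 0 0)" by auto
  next
    fix x assume "x \<in> demb (cf_term \<theta> 1) ` (carrier_mat 1 1 \<times> carrier_mat 0 0)"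
    then obtain C D where "C \<in> carrier_mat 1 1" "D \<in> carrier_mat 0 0" "x = demb (cf_term \<theta> 1) (C, D)"
      by blast
    then show "x \<in> range (AF_emb0 \<theta>)" by (simp only: emb rangeI)
  qed
  then show ?thesis by (simp add: 0 AF_sub_def dsub_def cf_den_prev_def)
next
  case (Suc i)
  then show ?thesis
    by (auto simp: AF_sub_def dsub_def cf_den_prev_def AF_def AF_emb_def demb_def bdiag_def image_def)
qed

text \<open>The sign in \<open>AF_t\<close> cancels that of the error, so t = q_N \<delta>_{N-1},
  and \<open>cf_den_delta\<close> turns 1 - t into q_{N-1} \<delta>_N; dividing by the matrix sizes
  leaves the two weights.\<close>

lemma AF_tau_eq_wtr: "AF_tau \<theta> (Suc j) = wtr (cf_delta \<theta> (Suc j)) (cf_delta \<theta> (Suc (Suc j)))"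
proof -
  have t: "AF_t \<theta> (Suc j) = real (cf_den \<theta> (Suc j)) * cf_delta \<theta> (Suc j)"
    unfolding AF_t_def using cf_approx_error[OF \<theta>, of j]
    by (simp add: mult.assoc flip: power_mult_distrib)
  have "AF_t \<theta> (Suc j) / real (cf_den \<theta> (Suc j)) = cf_delta \<theta> (Suc j)"
    using cf_den_pos[OF \<theta>, of "Suc j"] by (simp add: t)
  moreover have "(1 - AF_t \<theta> (Suc j)) / real (cf_den \<theta> j) = cf_delta \<theta> (Suc (Suc j))"
    using cf_den_pos[OF \<theta>, of j] cf_den_delta[OF \<theta>, of j] by (simp add: t field_simps)
  ultimately show ?thesis by (intro ext) (simp add: AF_tau_def wtr_def)
qed

lemma FR_norm_bounds:
  assumes a: "a \<in> AF \<theta> (Suc j)"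
  defines "r \<equiv> real (cf_term \<theta> (Suc j))"
  shows "sqrt (cf_delta \<theta> (Suc (Suc j)) / (cf_delta \<theta> j * r * (r + 1)\<^sup>2)) * opnorm a \<le> FR_norm \<theta> (Suc j) a"
    and "FR_norm \<theta> (Suc j) a \<le> opnorm a"
proof -
  let ?r = "cf_term \<theta> (Suc j)" and ?m = "cf_den \<theta> j" and ?k = "cf_den_prev \<theta> j"
  let ?w1 = "cf_delta \<theta> (Suc j)" and ?w2 = "cf_delta \<theta> (Suc (Suc j))"
  let ?G = "ds_mult (ds_star a) a"
  have irr: "\<theta> \<notin> \<rat>" using \<theta> by simp
  have w: "0 < ?w1" "0 < ?w2" "?w2 \<le> ?w1" and r0: "0 < ?r"
    using cf_delta_pos[OF irr] cf_delta_Suc_less[OF irr, of "Suc j"] cf_term_Suc_pos[OF \<theta>] by auto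
  have s: "real ?r * ?w1 + ?w2 = cf_delta \<theta> j"
    using cf_delta_rec[OF irr, of j] by (simp add: cf_term_eq_digit[OF \<theta>])
  have aA: "a \<in> dsum_alg (?r * ?m + ?k) ?m" using a by (simp add: AF_eq_dsum_alg)
  have GA: "?G \<in> dsum_alg (?r * ?m + ?k) ?m" by (intro dsum_alg_closed aA)
  define M where "M = opnorm (block_exp ?r ?m ?k ?w1 ?w2 ?G)"
  have FR: "FR_norm \<theta> (Suc j) a = sqrt M"
    unfolding FR_norm_def M_def AF_eq_dsum_alg AF_sub_eq_dsub AF_tau_eq_wtr
    by (simp only: cond_exp_eq_block_exp[OF w(1,2) r0 GA])
  have M0: "0 \<le> M" by (simp add: M_def opnorm_nonneg)
  have "M \<le> (opnorm a)\<^sup>2"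
    unfolding M_def
    using opnorm_block_exp[OF w(1,2) r0 GA] opnorm_star_mult[OF w(1,2) r0 aA] by (rule order.trans)
  then show "FR_norm \<theta> (Suc j) a \<le> opnorm a"
    unfolding FR using opnorm_nonneg by (intro real_le_lsqrt) auto
  have d: "0 < cf_delta \<theta> j" by (rule cf_delta_pos[OF irr])
  have r1: "1 \<le> r" using r0 by (simp add: r_def Suc_le_eq)
  have "opnorm a \<le> (r + 1) * sqrt (cf_delta \<theta> j / ?w2 * M)"
    using opnorm_le_block_exp[OF w(1,2) r0 aA w(3)] by (simp add: M_def s r_def)
  then have "sqrt (?w2 / (cf_delta \<theta> j * r * (r + 1)\<^sup>2)) * opnorm a
      \<le> sqrt (?w2 / (cf_delta \<theta> j * r * (r + 1)\<^sup>2)) * ((r + 1) * sqrt (cf_delta \<theta> j / ?w2 * M))"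
    using w d r1 by (intro mult_left_mono) auto
  also have "(r + 1) * sqrt (cf_delta \<theta> j / ?w2 * M) = sqrt ((r + 1)\<^sup>2 * (cf_delta \<theta> j / ?w2 * M))"
    using r1 by (simp add: real_sqrt_mult[of "(r + 1)\<^sup>2"] del: times_divide_eq_left times_divide_eq_right)
  also have "sqrt (?w2 / (cf_delta \<theta> j * r * (r + 1)\<^sup>2)) * sqrt ((r + 1)\<^sup>2 * (cf_delta \<theta> j / ?w2 * M)) = sqrt (M / r)"
    unfolding real_sqrt_mult[symmetric] using w d r1 by (intro arg_cong[of _ _ sqrt]) (simp add: divide_simps)
  \<comment> \<open>This is where the factor r of the constant is given away.\<close>
  also have "\<dots> \<le> sqrt M"
    using r1 M0 by (simp add: divide_le_eq mult_left_le mult_le_cancel_left1)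
  finally show "sqrt (?w2 / (cf_delta \<theta> j * r * (r + 1)\<^sup>2)) * opnorm a \<le> FR_norm \<theta> (Suc j) a"
    unfolding FR .
qed

end

theorem theorem5p2:
  fixes \<theta> :: real and N :: nat
  assumes "\<theta> \<in> {0<..<1} - \<rat>" and "N \<ge> 1"
  shows
    "(\<forall>a \<in> AF \<theta> N.
        sqrt ((\<theta> * cf_q \<theta> (int N) - cf_p \<theta> (int N))
              / ((\<theta> * cf_q \<theta> (int N - 2) - cf_p \<theta> (int N - 2))
                 * real (cf_term \<theta> N) * (real (cf_term \<theta> N) + 1)\<^sup>2)) * opnorm a
          \<le> FR_norm \<theta> N a
        \<and> FR_norm \<theta> N a \<le> opnorm a)
     \<and>
     (\<forall>(\<xi> :: nat \<Rightarrow> real) \<phi>.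
        (\<forall>n\<ge>1. \<xi> n \<in> {0<..<1} - \<rat>) \<and> \<phi> \<in> {0<..<1} - \<rat> \<and> \<xi> \<longlonglongrightarrow> \<phi> \<longrightarrow>
        (\<lambda>n. (\<xi> n * cf_q (\<xi> n) (int N) - cf_p (\<xi> n) (int N))
              / ((\<xi> n * cf_q (\<xi> n) (int N - 2) - cf_p (\<xi> n) (int N - 2))
                 * real (cf_term (\<xi> n) N) * (real (cf_term (\<xi> n) N) + 1)\<^sup>2))
        \<longlonglongrightarrow> (\<phi> * cf_q \<phi> (int N) - cf_p \<phi> (int N))
              / ((\<phi> * cf_q \<phi> (int N - 2) - cf_p \<phi> (int N - 2))
                 * real (cf_term \<phi> N) * (real (cf_term \<phi> N) + 1)\<^sup>2))"
proof -
  obtain j where N: "N = Suc j" using assms(2) by (cases N) auto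
  show ?thesis
    unfolding N cf_error_quotient[OF assms(1)]
    using FR_norm_bounds[OF assms(1)] cf_error_quotient_tendsto by blast
qed

end
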